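(* Let $J$ be a bounded half-line Jacobi matrix, let $N_j\to\infty$ be a sequence along which the limits described in the context exist, and let $\gamma:\mathbb{R}\to\mathbb{R}$ be the associated Lyapunov exponent and $g$ the associated Herglotz function. Let $$K = \left\{ c\in\mathbb{R} : \left| \gamma^{-1}(\{ c \} ) \right| > 0 \right\},\qquad C=\gamma^{-1}(K),$$ where $\gamma^{-1}$ denotes preimages under $\gamma:\mathbb{R}\to\mathbb{R}$. Then $g\in\mathcal{N}(C)$.
   Context: $|\cdot|$ is Lebesgue measure. A Herglotz function is a holomorphic map $F$ of $\mathbb{C}^+=\{z\in\mathbb{C}:\operatorname{Im}z>0\}$ to itself; $F(t)=\lim_{y\to0+}F(t+iy)$ exists for almost every $t\in\mathbb{R}$. For $S\subset\mathbb{R}$, $\mathcal{N}(S)$ is the set of Herglotz functions $F$ with $\operatorname{Re}F(t)=0$ for almost every $t\in S$. Setting: let $J$ be a half-line Jacobi matrix on $\ell_2(\mathbb{Z}_+)$, $\mathbb{Z}_+=\{1,2,\dots\}$: $(Ju)(n)=a(n)u(n+1)+a(n-1)u(n-1)+b(n)u(n)$ (term with $u(n-1)$ omitted for $n=1$), with real coefficients satisfying $(M+1)^{-1}\le a(n)\le M+1$, $|b(n)|\le M$ for some $M>0$. Put $a(0)=1$. For $z\in\mathbb{C}^+$ let $f_\pm(n,z)$ be the solutions of $a(n)f(n+1)+a(n-1)f(n-1)+b(n)f(n)=zf(n)$ ($n\ge1$) with $f_-(0,z)=0$, $f_-(1,z)=1$, $f_+(0,z)=1$, $f_+(1,z)=-\langle\delta_1,(J-z)^{-1}\delta_1\rangle$.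 Then $f_\pm(n,z)\ne0$ for $n\ge1$ and $z\mapsto\mp f_\pm(n+1,z)/f_\pm(n,z)$ are Herglotz functions. With the logarithm satisfying $\operatorname{Im}\ln\zeta\in(0,\pi)$ for $\zeta\in\mathbb{C}^+$, put $$w_\pm^{(N)}(z)=\frac1N\sum_{n=1}^N\ln\left[\mp\frac{f_\pm(n+1,z)}{f_\pm(n,z)}\right],\qquad g_N(z)=\frac1N\sum_{n=1}^N\langle\delta_n,(J-z)^{-1}\delta_n\rangle=\int_{\mathbb{R}}\frac{d\nu_N(t)}{t-z},$$ $d\nu_N(t)=\frac1N\sum_{n=1}^N d\|E(t)\delta_n\|^2$ ($E$ the spectral resolution of $J$), and $dk_N=\frac1N\sum_{n=1}^N\delta_{\lambda_n^{(N)}}$, where $\lambda_1^{(N)},\dots,\lambda_N^{(N)}$ are the eigenvalues of the truncation of $J$ to $\ell_2(\{1,\dots,N\})$ (boundary conditions $u(0)=u(N+1)=0$). $N_j\to\infty$ is a fixed (otherwise arbitrary) sequence such that, as $j\to\infty$, $w_\pm^{(N_j)}\to w_\pm$ and $g_{N_j}\to g$ uniformly on compact subsets of $\mathbb{C}^+$ with Herglotz limits, $\nu_{N_j}$ and $dk_{N_j}$ converge in weak $*$ sense to probability measures, and $(a(1)\cdots a(N_j))^{1/N_j}\to A>0$. Write $w_+=-\gamma+i\pi k$ with $\gamma,k$ real valued on $\mathbb{C}^+$, and put $\gamma(t)=\lim_{y\to0+}\gamma(t+iy)$, $k(t)=\lim_{y\to0+}k(t+iy)$ for $t\in\mathbb{R}$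 (these limits exist for every $t$, and $k(t)$ is increasing). $\gamma$ is called the Lyapunov exponent, and the measure $dk$ (which is also the weak $*$ limit of $dk_{N_j}$ and $\nu_{N_j}$) the density of states measure; $g(z)=\int_{\mathbb{R}}\frac{dk(t)}{t-z}$. *)

theory Defs
  imports "HOL-Complex_Analysis.Complex_Analysis" "HOL-Probability.Probability"
begin

section \<open>Herglotz functions and boundary values\<close>

definition upper_half_plane :: "complex set" where
  "upper_half_plane = {z. Im z > 0}"

definition herglotz :: "(complex \<Rightarrow> complex) \<Rightarrow> bool" where
  "herglotz F \<longleftrightarrow>
     F holomorphic_on upper_half_plane \<and> F ` upper_half_plane \<subseteq> upper_half_plane"

text \<open>
  As usual for \<^const>\<open>Lim\<close>, the value is unspecified at points where the limit does not exist.
  For a Herglotz function these points form a null set.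
\<close>

definition boundary_value :: "(complex \<Rightarrow> 'a::t2_space) \<Rightarrow> real \<Rightarrow> 'a" where
  "boundary_value F t = Lim (at_right 0) (\<lambda>y. F (Complex t y))"

definition herglotz_N :: "real set \<Rightarrow> (complex \<Rightarrow> complex) set" where
  "herglotz_N S =
     {F. herglotz F \<and> (AE t in lebesgue. t \<in> S \<longrightarrow> Re (boundary_value F t) = 0)}"

section \<open>The Hilbert space of square summable sequences on the positive integers\<close>

text \<open>
  Sequences indexed by \<open>{1, 2, \<dots>}\<close> are represented by functions on \<^typ>\<open>nat\<close> that vanish at \<open>0\<close>.
\<close>

definition ell2 :: "(nat \<Rightarrow> complex) set" where
  "ell2 = {u. u 0 = 0 \<and> summable (\<lambda>n. (cmod (u n))\<^sup>2)}"

definition ell2_inner :: "(nat \<Rightarrow> complex) \<Rightarrow> (nat \<Rightarrow> complex) \<Rightarrow> complex" where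
  "ell2_inner u v = (\<Sum>n. cnj (u n) * v n)"

definition ell2_norm :: "(nat \<Rightarrow> complex) \<Rightarrow> real" where
  "ell2_norm u = sqrt (\<Sum>n. (cmod (u n))\<^sup>2)"

definition delta :: "nat \<Rightarrow> nat \<Rightarrow> complex" where
  "delta n = (\<lambda>m. if m = n then 1 else 0)"

definition orthogonal_projection :: "((nat \<Rightarrow> complex) \<Rightarrow> (nat \<Rightarrow> complex)) \<Rightarrow> bool" where
  "orthogonal_projection P \<longleftrightarrow>
     (\<forall>u\<in>ell2. P u \<in> ell2) \<and>
     (\<forall>u\<in>ell2. \<forall>v\<in>ell2. \<forall>c. P (\<lambda>n. u n + c * v n) = (\<lambda>n. P u n + c * P v n)) \<and>
     (\<forall>u\<in>ell2. P (P u) = P u) \<and>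
     (\<forall>u\<in>ell2. \<forall>v\<in>ell2. ell2_inner (P u) v = ell2_inner u (P v))"

definition spectral_family :: "(real \<Rightarrow> (nat \<Rightarrow> complex) \<Rightarrow> (nat \<Rightarrow> complex)) \<Rightarrow> bool" where
  "spectral_family E \<longleftrightarrow>
     (\<forall>t. orthogonal_projection (E t)) \<and>
     (\<forall>s t. s \<le> t \<longrightarrow> (\<forall>u\<in>ell2. E s (E t u) = E s u)) \<and>
     (\<forall>u\<in>ell2. \<forall>t. ((\<lambda>s. ell2_norm (\<lambda>n. E s u n - E t u n)) \<longlongrightarrow> 0) (at_right t)) \<and>
     (\<forall>u\<in>ell2. ((\<lambda>t. ell2_norm (E t u)) \<longlongrightarrow> 0) at_bot) \<and>
     (\<forall>u\<in>ell2. ((\<lambda>t. ell2_norm (\<lambda>n. E t u n - u n)) \<longlongrightarrow> 0) at_top)"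

definition spectral_measure ::
  "(real \<Rightarrow> (nat \<Rightarrow> complex) \<Rightarrow> (nat \<Rightarrow> complex)) \<Rightarrow> (nat \<Rightarrow> complex) \<Rightarrow> real measure" where
  "spectral_measure E u = interval_measure (\<lambda>t. (ell2_norm (E t u))\<^sup>2)"

text \<open>
  \<open>T = \<integral> t dE(t)\<close> for an everywhere defined operator \<open>T\<close>: every vector lies in the domain
  \<open>\<integral> t\<^sup>2 d\<parallel>E(t)u\<parallel>\<^sup>2 < \<infinity>\<close> of the integral, and the quadratic forms agree, which by polarization
  determines the operator.
\<close>

definition spectral_resolution ::
  "((nat \<Rightarrow> complex) \<Rightarrow> (nat \<Rightarrow> complex)) \<Rightarrow>
   (real \<Rightarrow> (nat \<Rightarrow> complex) \<Rightarrow> (nat \<Rightarrow> complex)) \<Rightarrow> bool" where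
  "spectral_resolution T E \<longleftrightarrow> spectral_family E \<and>
     (\<forall>u\<in>ell2. integrable (spectral_measure E u) (\<lambda>t. t\<^sup>2) \<and>
               ell2_inner u (T u) = of_real (\<integral>t. t \<partial>spectral_measure E u))"

section \<open>Half-line Jacobi matrices\<close>

definition jacobi :: "(nat \<Rightarrow> real) \<Rightarrow> (nat \<Rightarrow> real) \<Rightarrow> (nat \<Rightarrow> complex) \<Rightarrow> (nat \<Rightarrow> complex)" where
  "jacobi a b u n =
     (if n = 0 then 0
      else of_real (a n) * u (n + 1)
         + (if n = 1 then 0 else of_real (a (n - 1)) * u (n - 1))
         + of_real (b n) * u n)"

definition jacobi_resolvent ::
  "(nat \<Rightarrow> real) \<Rightarrow> (nat \<Rightarrow> real) \<Rightarrow> complex \<Rightarrow> (nat \<Rightarrow> complex) \<Rightarrow> (nat \<Rightarrow> complex)" where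
  "jacobi_resolvent a b z = the_inv_into ell2 (\<lambda>u n. jacobi a b u n - z * u n)"

definition green :: "(nat \<Rightarrow> real) \<Rightarrow> (nat \<Rightarrow> real) \<Rightarrow> nat \<Rightarrow> complex \<Rightarrow> complex" where
  "green a b n z = ell2_inner (delta n) (jacobi_resolvent a b z (delta n))"

text \<open>
  The solution of the difference equation with prescribed values \<open>c0\<close>, \<open>c1\<close> at \<open>0\<close> and \<open>1\<close>;
  here, in contrast to \<^const>\<open>jacobi\<close>, the coefficient \<open>a 0\<close> enters.
\<close>

fun jacobi_solution ::
  "(nat \<Rightarrow> real) \<Rightarrow> (nat \<Rightarrow> real) \<Rightarrow> complex \<Rightarrow> complex \<Rightarrow> complex \<Rightarrow> nat \<Rightarrow> complex" where
  "jacobi_solution a b z c0 c1 0 = c0"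
| "jacobi_solution a b z c0 c1 (Suc 0) = c1"
| "jacobi_solution a b z c0 c1 (Suc (Suc n)) =
     ((z - of_real (b (Suc n))) * jacobi_solution a b z c0 c1 (Suc n)
       - of_real (a n) * jacobi_solution a b z c0 c1 n) / of_real (a (Suc n))"

lemma jacobi_solution_unique:
  assumes a: "\<And>n. n \<ge> 1 \<Longrightarrow> a n \<noteq> 0"
  shows "f = jacobi_solution a b z c0 c1 \<longleftrightarrow>
    f 0 = c0 \<and> f 1 = c1 \<and>
    (\<forall>n\<ge>1. of_real (a n) * f (n + 1) + of_real (a (n - 1)) * f (n - 1) + of_real (b n) * f n
            = z * f n)"
    (is "_ \<longleftrightarrow> _ \<and> _ \<and> ?eq")
proof (intro iffI conjI)
  assume f: "f = jacobi_solution a b z c0 c1"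
  show "f 0 = c0" "f 1 = c1" by (simp_all add: f)
  show ?eq
  proof (intro allI impI)
    fix n :: nat assume "n \<ge> 1"
    then obtain m where n: "n = Suc m" by (cases n) auto
    show "of_real (a n) * f (n + 1) + of_real (a (n - 1)) * f (n - 1) + of_real (b n) * f n
            = z * f n"
      using a[of "Suc m"] by (simp add: n f field_simps)
  qed
next
  assume *: "f 0 = c0 \<and> f 1 = c1 \<and> ?eq"
  show "f = jacobi_solution a b z c0 c1"
  proof
    fix n show "f n = jacobi_solution a b z c0 c1 n"
    proof (induction n rule: induct_nat_012)
      case (ge2 n)
      have "of_real (a (Suc n)) * f (Suc (Suc n)) =
            (z - of_real (b (Suc n))) * f (Suc n) - of_real (a n) * f n"
        using *[THEN conjunct2, THEN conjunct2, rule_format, of "Suc n"]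
        by (simp add: algebra_simps eq_diff_eq)
      then show ?case
        using ge2 a[of "Suc n"] by (simp add: field_simps)
    qed (use * in auto)
  qed
qed

definition f_minus :: "(nat \<Rightarrow> real) \<Rightarrow> (nat \<Rightarrow> real) \<Rightarrow> nat \<Rightarrow> complex \<Rightarrow> complex" where
  "f_minus a b n z = jacobi_solution a b z 0 1 n"

definition f_plus :: "(nat \<Rightarrow> real) \<Rightarrow> (nat \<Rightarrow> real) \<Rightarrow> nat \<Rightarrow> complex \<Rightarrow> complex" where
  "f_plus a b n z = jacobi_solution a b z 1 (- green a b 1 z) n"

text \<open>
  The principal branch \<^const>\<open>Ln\<close> satisfies \<open>0 < Im (Ln \<zeta>) < \<pi>\<close> on the upper half plane.
\<close>

definition w_plus_avg :: "(nat \<Rightarrow> real) \<Rightarrow> (nat \<Rightarrow> real) \<Rightarrow> nat \<Rightarrow> complex \<Rightarrow> complex" where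
  "w_plus_avg a b N z =
     (1 / of_nat N) * (\<Sum>n=1..N. Ln (- (f_plus a b (n + 1) z / f_plus a b n z)))"

definition w_minus_avg :: "(nat \<Rightarrow> real) \<Rightarrow> (nat \<Rightarrow> real) \<Rightarrow> nat \<Rightarrow> complex \<Rightarrow> complex" where
  "w_minus_avg a b N z =
     (1 / of_nat N) * (\<Sum>n=1..N. Ln (f_minus a b (n + 1) z / f_minus a b n z))"

definition green_avg :: "(nat \<Rightarrow> real) \<Rightarrow> (nat \<Rightarrow> real) \<Rightarrow> nat \<Rightarrow> complex \<Rightarrow> complex" where
  "green_avg a b N z = (1 / of_nat N) * (\<Sum>n=1..N. green a b n z)"

definition nu_avg :: "(real \<Rightarrow> (nat \<Rightarrow> complex) \<Rightarrow> (nat \<Rightarrow> complex)) \<Rightarrow> nat \<Rightarrow> real measure" where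
  "nu_avg E N =
     interval_measure (\<lambda>t. (1 / real N) * (\<Sum>n=1..N. (ell2_norm (E t (delta n)))\<^sup>2))"

definition truncation_eigenvalues :: "(nat \<Rightarrow> real) \<Rightarrow> (nat \<Rightarrow> real) \<Rightarrow> nat \<Rightarrow> real set" where
  "truncation_eigenvalues a b N =
     {l. \<exists>u. u \<noteq> (\<lambda>_. 0) \<and> (\<forall>n. n \<notin> {1..N} \<longrightarrow> u n = 0) \<and>
             (\<forall>n\<in>{1..N}. jacobi a b u n = of_real l * u n)}"

text \<open>
  The averaged sum of point masses at the eigenvalues, given by its distribution function.
  No multiplicities are needed: an eigenvector of the truncation is determined by its first entry
  as long as \<open>a n \<noteq> 0\<close>, so there are \<open>N\<close> distinct (real) eigenvalues.
\<close>

definition dk_avg :: "(nat \<Rightarrow> real) \<Rightarrow> (nat \<Rightarrow> real) \<Rightarrow> nat \<Rightarrow> real measure" where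
  "dk_avg a b N =
     interval_measure (\<lambda>t. (1 / real N) * real (card {l \<in> truncation_eigenvalues a b N. l \<le> t}))"

section \<open>Modes of convergence\<close>

definition loc_unif_limit ::
  "(nat \<Rightarrow> complex \<Rightarrow> complex) \<Rightarrow> (complex \<Rightarrow> complex) \<Rightarrow> bool" where
  "loc_unif_limit F G \<longleftrightarrow>
     (\<forall>K. compact K \<and> K \<subseteq> upper_half_plane \<longrightarrow> uniform_limit K F G sequentially)"

text \<open>Weak \<open>*\<close> convergence in the dual of the continuous functions vanishing at infinity.\<close>

definition weak_star_limit :: "(nat \<Rightarrow> real measure) \<Rightarrow> real measure \<Rightarrow> bool" where
  "weak_star_limit \<mu> \<mu>' \<longleftrightarrow>
     (\<forall>h :: real \<Rightarrow> real. continuous_on UNIV h \<and> (h \<longlongrightarrow> 0) at_infinity \<longrightarrow>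
        (\<lambda>j. \<integral>t. h t \<partial>\<mu> j) \<longlonglongrightarrow> (\<integral>t. h t \<partial>\<mu>'))"

section \<open>The Lyapunov exponent\<close>

text \<open>On the upper half plane \<open>w = - \<gamma> + \<i> \<pi> k\<close> with real valued \<open>\<gamma>\<close> and \<open>k\<close>.\<close>

definition lyapunov_exponent :: "(complex \<Rightarrow> complex) \<Rightarrow> real \<Rightarrow> real" where
  "lyapunov_exponent w = boundary_value (\<lambda>z. - Re (w z))"

end

theory Submission imports Defs begin

text \<open>
  The limit \<open>w\<close> of the averaged logarithms is a primitive of \<open>g\<close>: \<open>w' = g\<close> on the upper half plane. Given
  this, the Jacobi matrix can be forgotten, and what remains is a statement about a Herglotz function
  \<open>g\<close> and a primitive \<open>F\<close> of it: if \<open>Re F\<close> has the same boundary value \<open>c\<close> at many points, then \<open>Re g\<close>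
  vanishes there. At a point \<open>t\<close> where \<open>g\<close> has a nontangential limit \<open>d\<close>, integrate \<open>g\<close> along a path that
  rises from \<open>t\<close> to the height \<open>\<epsilon>\<bar>s - t\<bar>\<close>, moves horizontally to a second point \<open>s\<close> of the level set, and
  descends. The horizontal part contributes \<open>d (s - t)\<close> up to a small error, because it lies in a fixed
  Stolz angle at \<open>t\<close>; the vertical parts contribute \<open>O(\<epsilon>\<bar>s - t\<bar>)\<close> if \<open>g\<close> is bounded on the vertical
  segments over \<open>s\<close> and \<open>t\<close>. Since the real part does not change from \<open>t\<close> to \<open>s\<close>, letting \<open>s\<close> tend to \<open>t\<close>
  gives \<open>Re d = 0\<close>. The level set is a countable union of pieces over which \<open>g\<close> is uniformly bounded on
  vertical segments of a fixed length, and each piece has only countably many isolated points, so each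
  level set has at most countably many exceptional points (\<open>countable_exceptions_on_level_set\<close>). Only
  countably many level sets have positive measure, because they are disjoint.

  Two ingredients are needed. The first is \<open>w' = g\<close>. With \<open>k = \<partial>f\<^sub>+/\<partial>z\<close> and \<open>l\<^sub>n = k(n)/f\<^sub>+(n)\<close>, the
  derivative of the sum of logarithms telescopes to \<open>l\<^sub>N\<^sub>+\<^sub>1 - l\<^sub>1\<close>, while the diagonal Green function is
  \<open>- f\<^sub>- f\<^sub>+\<close>, whose sum is a Wronskian of \<open>f\<^sub>-\<close> and \<open>k\<close>. The two sums differ by \<open>l\<^sub>1\<close> and two terms \<open>m\<^sub>+'/(m\<^sub>+ + m)\<close> with
  \<open>m\<^sub>+\<close> a Herglotz function and \<open>Im m \<ge> 0\<close>. By the Schwarz lemma such terms are bounded uniformly in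
  \<open>N\<close>, so that all of them disappear after division by \<open>N\<close> (\<open>deriv_w_plus_avg_green_avg\<close>).

  The second is Fatou's theorem: a Herglotz function has finite nontangential limits almost
  everywhere (\<open>Fatou_herglotz\<close>). For a bounded function, take a primitive; it extends to a Lipschitz
  function on the real line, which is differentiable almost everywhere by a Vitali covering argument.
  Blowing up at a point of differentiability and using normal families, every limit is a holomorphic
  function whose boundary values are those of a linear function, hence it is linear by Schwarz
  reflection. A general Herglotz function \<open>g\<close> reduces to the bounded function \<open>q = g/(g + \<i>)\<close>, once the set where
  \<open>q\<close> tends to \<open>1\<close> is known to be null; this follows by comparing integrals of \<open>q\<^sup>n\<close> at two heights.
\<close>

section \<open>The upper half plane\<close>

lemma upper_half_plane_iff [simp]: "z \<in> upper_half_plane \<longleftrightarrow> Im z > 0"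
  by (simp add: upper_half_plane_def)

lemma open_upper_half_plane [simp, intro]: "open upper_half_plane"
  unfolding upper_half_plane_def by (rule open_halfspace_Im_gt)

lemma compact_upper_half_plane_Im_bound:
  assumes "compact K" "K \<subseteq> upper_half_plane"
  obtains d where "d > 0" "\<And>z. z \<in> K \<Longrightarrow> d \<le> Im z"
proof (cases "K = {}")
  case False
  have "continuous_on K Im" by (intro continuous_intros)
  from continuous_attains_inf[OF assms(1) False this] obtain z0 where
    "z0 \<in> K" "\<forall>z\<in>K. Im z0 \<le> Im z" by blast
  then show ?thesis using assms(2) by (intro that[of "Im z0"]) auto
qed (rule that[of 1], auto)

text \<open>
  This is the Schwarz lemma for the disc around \<open>z\<close> of radius \<open>Im z\<close>, composed with the Cayley map at
  \<open>F z\<close>. Working with this disc instead of the whole half plane costs the factor \<open>2\<close>.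
\<close>

lemma herglotz_deriv_bound:
  assumes hol: "F holomorphic_on upper_half_plane" and up: "\<And>z. Im z > 0 \<Longrightarrow> Im (F z) > 0"
    and z: "Im z > 0"
  shows "cmod (deriv F z) \<le> 2 * Im (F z) / Im z"
proof -
  define y w where "y = Im z" and "w = F z"
  have y: "y > 0" and w: "Im w > 0" using z up[OF z] by (simp_all add: y_def w_def)
  define h where "h = (\<lambda>\<zeta>. (F (z + of_real y * \<zeta>) - w) / (F (z + of_real y * \<zeta>) - cnj w))"
  have arg: "Im (z + of_real y * \<zeta>) > 0" if "norm \<zeta> < 1" for \<zeta>
  proof -
    have "\<bar>Im \<zeta>\<bar> < 1" using that abs_Im_le_cmod[of \<zeta>] by linarith
    then have "y * Im \<zeta> > y * (-1)" using y by (intro mult_strict_left_mono) auto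
    then show ?thesis by (simp add: y_def)
  qed
  have nz: "F (z + of_real y * \<zeta>) - cnj w \<noteq> 0" if "norm \<zeta> < 1" for \<zeta>
    using up[OF arg[OF that]] w by (auto simp: complex_eq_iff)
  have holF: "(\<lambda>\<zeta>. F (z + of_real y * \<zeta>)) holomorphic_on ball 0 1"
    by (rule holomorphic_on_compose_gen[OF _ hol, unfolded o_def])
       (use arg in \<open>auto intro!: holomorphic_intros\<close>)
  have "h holomorphic_on ball 0 1"
    unfolding h_def using nz by (intro holomorphic_intros holF) auto
  moreover have "h 0 = 0" by (simp add: h_def w_def)
  moreover have "norm (h \<zeta>) < 1" if "norm \<zeta> < 1" for \<zeta>
  proof -
    let ?v = "F (z + of_real y * \<zeta>)"
    have "(cmod (?v - w))\<^sup>2 < (cmod (?v - cnj w))\<^sup>2"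
      using up[OF arg[OF that]] w unfolding cmod_power2
      by (simp add: power2_eq_square algebra_simps)
    then have "cmod (?v - w) < cmod (?v - cnj w)" by (rule power_less_imp_less_base) simp
    then show ?thesis unfolding h_def by (simp add: norm_divide divide_less_eq)
  qed
  ultimately have "norm (deriv h 0) \<le> 1"
    using Schwarz_Lemma(2)[of h 0] by simp
  moreover have "(h has_field_derivative (of_real y * deriv F z) / (w - cnj w)) (at 0)"
  proof -
    have dF: "(F has_field_derivative deriv F z) (at z)"
      using hol z by (intro holomorphic_derivI[of _ upper_half_plane]) auto
    have "((\<lambda>\<zeta>. F (z + of_real y * \<zeta>)) has_field_derivative deriv F z * of_real y) (at 0)"
      by (rule DERIV_chain2[where f = F]) (use dF in \<open>auto intro!: derivative_eq_intros\<close>)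
    then have "(h has_field_derivative (deriv F z * of_real y * (w - cnj w) - (w - w) * (deriv F z * of_real y))
        / ((w - cnj w) * (w - cnj w))) (at 0)"
      using nz[of 0] unfolding h_def by (auto intro!: derivative_eq_intros simp: w_def)
    moreover have "w - cnj w \<noteq> 0" using nz[of 0] by (simp add: w_def)
    ultimately show ?thesis by (simp add: mult.commute)
  qed
  then have "deriv h 0 = (of_real y * deriv F z) / (w - cnj w)" by (rule DERIV_imp_deriv)
  moreover have "cmod (w - cnj w) = 2 * Im w"
    using w by (simp add: complex_diff_cnj norm_mult)
  ultimately have "y * cmod (deriv F z) / (2 * Im w) \<le> 1"
    using y by (simp add: norm_divide norm_mult)
  then show ?thesis using y w by (simp add: y_def w_def field_simps)
qed

section \<open>Solutions of the Jacobi difference equation\<close>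

text \<open>
  The difference equation is indexed by \<open>n + 1\<close>, so that it runs over the positive integers and involves the
  coefficient \<open>a 0\<close>.
\<close>

definition solves :: "(nat \<Rightarrow> real) \<Rightarrow> (nat \<Rightarrow> real) \<Rightarrow> complex \<Rightarrow> (nat \<Rightarrow> complex) \<Rightarrow> bool" where
  "solves a b z u \<longleftrightarrow> (\<forall>n. of_real (a (Suc n)) * u (Suc (Suc n)) + of_real (a n) * u n
      + of_real (b (Suc n)) * u (Suc n) = z * u (Suc n))"

text \<open>
  Up to the factor \<open>2\<i>\<close>, this is the Wronskian of \<open>u\<close> with its complex conjugate. Its sign decides on which side
  of the real line the quotient \<open>u (n + 1) / u n\<close> lies.
\<close>

definition current :: "(nat \<Rightarrow> real) \<Rightarrow> (nat \<Rightarrow> complex) \<Rightarrow> nat \<Rightarrow> real" where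
  "current a u n = a n * Im (u (Suc n) * cnj (u n))"

definition wronskian :: "(nat \<Rightarrow> real) \<Rightarrow> (nat \<Rightarrow> complex) \<Rightarrow> (nat \<Rightarrow> complex) \<Rightarrow> nat \<Rightarrow> complex" where
  "wronskian a u v n = of_real (a n) * (u (Suc n) * v n - u n * v (Suc n))"

lemma current_Suc:
  assumes "solves a b z u"
  shows "current a u (Suc n) = current a u n + Im z * (cmod (u (Suc n)))\<^sup>2"
proof -
  have eq: "of_real (a (Suc n)) * u (Suc (Suc n)) = z * u (Suc n) - of_real (a n) * u n
      - of_real (b (Suc n)) * u (Suc n)"
    using assms[unfolded solves_def, rule_format, of n] by (simp add: algebra_simps)
  have "current a u (Suc n) = Im (of_real (a (Suc n)) * u (Suc (Suc n)) * cnj (u (Suc n)))"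
    by (simp add: current_def algebra_simps)
  also have "\<dots> = Im z * (cmod (u (Suc n)))\<^sup>2 + current a u n"
    unfolding eq current_def cmod_power2 by (simp add: algebra_simps power2_eq_square)
  finally show ?thesis by simp
qed

lemma current_eq_sum:
  assumes "solves a b z u"
  shows "current a u n = current a u 0 + Im z * (\<Sum>k=1..n. (cmod (u k))\<^sup>2)"
  by (induction n) (simp_all add: current_Suc[OF assms] algebra_simps)

lemma current_mono:
  assumes "solves a b z u" "Im z \<ge> 0" "m \<le> n"
  shows "current a u m \<le> current a u n"
  by (rule lift_Suc_mono_le[OF _ \<open>m \<le> n\<close>]) (simp add: current_Suc[OF assms(1)] assms(2))

lemma wronskian_const:
  assumes "solves a b z u" "solves a b z v"
  shows "wronskian a u v n = wronskian a u v 0"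
proof (induction n)
  case (Suc n)
  have u: "of_real (a (Suc n)) * u (Suc (Suc n)) = z * u (Suc n) - of_real (a n) * u n
      - of_real (b (Suc n)) * u (Suc n)" and
    v: "of_real (a (Suc n)) * v (Suc (Suc n)) = z * v (Suc n) - of_real (a n) * v n
      - of_real (b (Suc n)) * v (Suc n)"
    using assms[unfolded solves_def, THEN spec[of _ n]] by (simp_all add: algebra_simps)
  have "wronskian a u v (Suc n) = (of_real (a (Suc n)) * u (Suc (Suc n))) * v (Suc n)
      - u (Suc n) * (of_real (a (Suc n)) * v (Suc (Suc n)))"
    by (simp add: wronskian_def algebra_simps)
  also have "\<dots> = wronskian a u v n"
    unfolding u v wronskian_def by (simp add: algebra_simps)
  finally show ?case using Suc by simp
qed simp

lemma solves_eq_0: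
  assumes "solves a b z u" "\<And>n. a n \<noteq> 0" "u n = 0" "u (Suc n) = 0"
  shows "u 0 = 0"
  using assms(3,4)
proof (induction n)
  case (Suc n)
  have "of_real (a n) * u n = 0"
    using assms(1)[unfolded solves_def, THEN spec[of _ n]] Suc.prems by simp
  then show ?case using Suc assms(2)[of n] by simp
qed

locale jacobi_coefficients =
  fixes a b :: "nat \<Rightarrow> real" and M :: real
  assumes M_pos: "M > 0" and a_0: "a 0 = 1"
    and a_bounds: "\<And>n. n \<ge> 1 \<Longrightarrow> inverse (M + 1) \<le> a n \<and> a n \<le> M + 1"
    and b_bound: "\<And>n. n \<ge> 1 \<Longrightarrow> \<bar>b n\<bar> \<le> M"
begin

lemma a_pos: "a n > 0"
proof (cases "n = 0")
  case False
  then have "inverse (M + 1) \<le> a n" using a_bounds[of n] by auto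
  moreover have "inverse (M + 1) > 0" using M_pos by simp
  ultimately show ?thesis by linarith
qed (simp add: a_0)

lemma a_nonzero: "a n \<noteq> 0" using a_pos[of n] by simp

lemma a_le: "a n \<le> M + 1"
  using a_bounds[of n] a_0 M_pos by (cases "n = 0") auto

lemma solves_jacobi_solution: "solves a b z (jacobi_solution a b z c d)"
  unfolding solves_def using a_nonzero by (simp add: field_simps)

lemma solves_f_minus: "solves a b z (\<lambda>n. f_minus a b n z)"
  unfolding f_minus_def by (rule solves_jacobi_solution)

lemma f_minus_0 [simp]: "f_minus a b 0 z = 0" and f_minus_1 [simp]: "f_minus a b (Suc 0) z = 1"
  by (simp_all add: f_minus_def)

lemma current_f_minus_pos:
  assumes "Im z > 0" shows "current a (\<lambda>n. f_minus a b n z) (Suc n) > 0"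
proof -
  have "current a (\<lambda>n. f_minus a b n z) 1 \<le> current a (\<lambda>n. f_minus a b n z) (Suc n)"
    using assms by (intro current_mono[OF solves_f_minus]) auto
  moreover have "current a (\<lambda>n. f_minus a b n z) 1 = Im z"
    using current_Suc[OF solves_f_minus[of z], of 0] by (simp add: current_def)
  ultimately show ?thesis using assms by simp
qed

lemma f_minus_nonzero:
  assumes "Im z > 0" "n \<ge> 1" shows "f_minus a b n z \<noteq> 0"
  using current_f_minus_pos[OF assms(1), of "n - 1"] assms(2)
  by (cases n) (auto simp: current_def)

lemma Im_div: "Im (x / y) = Im (x * cnj y) / (cmod y)\<^sup>2"
  by (metis Im_divide_of_real complex_div_cnj of_real_power)

lemma Im_quotient_eq_current:
  "Im (u (Suc n) / u n) = current a u n / (a n * (cmod (u n))\<^sup>2)"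
  using a_nonzero[of n] by (simp add: Im_div current_def)

lemma f_minus_quotient:
  assumes "Im z > 0" "n \<ge> 1"
  shows "Im (f_minus a b (Suc n) z / f_minus a b n z) > 0"
proof -
  obtain m where n: "n = Suc m" using assms(2) by (cases n) auto
  show ?thesis
    unfolding Im_quotient_eq_current[of "\<lambda>n. f_minus a b n z"] unfolding n
    using current_f_minus_pos[OF assms(1), of m] a_pos[of "Suc m"]
      f_minus_nonzero[OF assms(1), of "Suc m"]
    by (intro divide_pos_pos mult_pos_pos) auto
qed

end

section \<open>The Weyl solution and the Green function\<close>

lemma holomorphic_jacobi_solution:
  assumes "c holomorphic_on S" "d holomorphic_on S" "\<And>n. a (Suc n) \<noteq> 0"
  shows "(\<lambda>z. jacobi_solution a b z (c z) (d z) n) holomorphic_on S"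
proof (induction n rule: induct_nat_012)
  case (ge2 n)
  then show ?case using assms(3)[of n] by (auto intro!: holomorphic_intros)
qed (use assms in auto)

lemma jacobi_solution_lincomb:
  "jacobi_solution a b z c d n = c * jacobi_solution a b z 1 0 n + d * jacobi_solution a b z 0 1 n"
proof (induction n rule: induct_nat_012)
  case (ge2 n)
  then show ?case by (simp add: algebra_simps add_divide_distrib diff_divide_distrib)
qed auto

lemma delta_inner: "ell2_inner (delta n) v = v n"
proof -
  have "(\<lambda>m. cnj (delta n m) * v m) = (\<lambda>m. if m = n then v m else 0)"
    by (auto simp: delta_def)
  then show ?thesis unfolding ell2_inner_def
    using sums_single[of n v, THEN sums_unique] by simp
qed

context jacobi_coefficients
begin

lemma tendsto_current_0:
  assumes "u \<longlonglongrightarrow> 0" shows "current a u \<longlonglongrightarrow> 0"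
proof (rule Lim_null_comparison[where g = "\<lambda>n. (M + 1) * (cmod (u (Suc n)) * cmod (u n))"])
  have "\<bar>current a u n\<bar> \<le> (M + 1) * (cmod (u (Suc n)) * cmod (u n))" for n
  proof -
    have "\<bar>Im (u (Suc n) * cnj (u n))\<bar> \<le> cmod (u (Suc n)) * cmod (u n)"
      using abs_Im_le_cmod[of "u (Suc n) * cnj (u n)"] by (simp add: norm_mult)
    moreover have "\<bar>a n\<bar> \<le> M + 1" using a_le[of n] a_pos[of n] by simp
    ultimately show ?thesis unfolding current_def abs_mult
      using M_pos by (intro mult_mono) auto
  qed
  then show "\<forall>\<^sub>F n in sequentially. norm (current a u n) \<le> (M + 1) * (cmod (u (Suc n)) * cmod (u n))"
    by simp
  have "(\<lambda>n. (M + 1) * (cmod (u (Suc n)) * cmod (u n))) \<longlonglongrightarrow> (M + 1) * (0 * 0)"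
    using assms LIMSEQ_Suc[OF assms] by (intro tendsto_intros tendsto_norm_zero)
  then show "(\<lambda>n. (M + 1) * (cmod (u (Suc n)) * cmod (u n))) \<longlonglongrightarrow> 0" by simp
qed

lemma square_summable_tendsto_0:
  assumes "summable (\<lambda>n. (cmod (u n))\<^sup>2)" shows "u \<longlonglongrightarrow> 0"
proof -
  have "(\<lambda>n. sqrt ((cmod (u n))\<^sup>2)) \<longlonglongrightarrow> sqrt 0"
    using summable_LIMSEQ_zero[OF assms] by (intro tendsto_intros)
  then show ?thesis by (simp add: tendsto_norm_zero_iff)
qed

lemma current_nonpos:
  assumes "solves a b z u" "u \<longlonglongrightarrow> 0" "Im z \<ge> 0"
  shows "current a u n \<le> 0"
  using LIMSEQ_le_const[OF tendsto_current_0[OF assms(2)], of "current a u n"]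
    current_mono[OF assms(1,3), of n] by blast

text \<open>
  The current starts at zero, increases, and tends to zero. This is the uniqueness behind
  the invertibility of \<open>J - z\<close>.
\<close>

lemma decaying_solution_eq_0:
  assumes "solves a b z u" "u \<longlonglongrightarrow> 0" "Im z > 0" "u 0 = 0"
  shows "u = (\<lambda>_. 0)"
proof
  fix n
  have "current a u 0 = 0" using assms(4) by (simp add: current_def)
  then have *: "current a u n \<ge> 0" "current a u n \<le> 0" for n
    using current_mono[OF assms(1), of 0 n] assms(3) current_nonpos[OF assms(1,2), of n] by auto
  show "u n = 0"
  proof (cases n)
    case (Suc k)
    have "Im z * (cmod (u (Suc k)))\<^sup>2 = 0"
      using current_Suc[OF assms(1), of k] *[of k] *[of "Suc k"] by linarith
    then show ?thesis using assms(3) Suc by simp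
  qed (use assms(4) in simp)
qed

text \<open>
  Two consecutive zeros of a solution make it vanish identically, so a current that increases to zero
  cannot reach it.
\<close>

lemma current_neg:
  assumes "solves a b z u" "u \<longlonglongrightarrow> 0" "Im z > 0" "u 0 \<noteq> 0"
  shows "current a u n < 0"
proof (rule ccontr)
  assume "\<not> ?thesis"
  then have "current a u m = 0" if "m \<ge> n" for m
    using current_mono[OF assms(1) _ that] current_nonpos[OF assms(1,2), of m] assms(3) by auto
  then have "u (Suc m) = 0" if "m \<ge> n" for m
    using current_Suc[OF assms(1), of m] that assms(3) by auto
  then have "u (Suc n) = 0" "u (Suc (Suc n)) = 0" by auto
  then show False using solves_eq_0[OF assms(1) a_nonzero, of "Suc n"] assms(4) by blast
qed

text \<open>
  Since \<^const>\<open>jacobi_resolvent\<close> is defined as a partial inverse on \<^const>\<open>ell2\<close>, it can be evaluated at a vector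
  by exhibiting a preimage, once \<open>J - z\<close> is known to be injective.
\<close>

lemma jacobi_resolvent_eqI:
  assumes "Im z > 0" "u \<in> ell2" "\<And>n. jacobi a b u n - z * u n = v n"
  shows "jacobi_resolvent a b z v = u"
  unfolding jacobi_resolvent_def
proof (rule the_inv_into_f_eq)
  show "inj_on (\<lambda>u n. jacobi a b u n - z * u n) ell2"
  proof (rule inj_onI)
    fix x y assume xy: "x \<in> ell2" "y \<in> ell2"
      and eq: "(\<lambda>n. jacobi a b x n - z * x n) = (\<lambda>n. jacobi a b y n - z * y n)"
    define w where "w = (\<lambda>n. x n - y n)"
    have 0: "x 0 = 0" "y 0 = 0" using xy by (auto simp: ell2_def)
    have "solves a b z w" unfolding solves_def
    proof
      fix n
      have "jacobi a b x (Suc n) - z * x (Suc n) = jacobi a b y (Suc n) - z * y (Suc n)"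
        using fun_cong[OF eq] .
      then show "of_real (a (Suc n)) * w (Suc (Suc n)) + of_real (a n) * w n
          + of_real (b (Suc n)) * w (Suc n) = z * w (Suc n)"
        using 0 by (cases "n = 0") (auto simp: jacobi_def w_def algebra_simps)
    qed
    moreover have "w \<longlonglongrightarrow> 0"
    proof -
      have "x \<longlonglongrightarrow> 0" "y \<longlonglongrightarrow> 0"
        using xy square_summable_tendsto_0 unfolding ell2_def by auto
      then have "(\<lambda>n. x n - y n) \<longlonglongrightarrow> 0 - 0" by (intro tendsto_intros)
      then show ?thesis unfolding w_def by simp
    qed
    ultimately have "w = (\<lambda>_. 0)"
      using assms(1) 0 by (intro decaying_solution_eq_0) (auto simp: w_def)
    then show "x = y" by (auto simp: w_def fun_eq_iff)
  qed
qed (use assms in auto)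

text \<open>
  Weyl's limit point construction. The solution that vanishes at \<open>N + 2\<close> has \<open>\<ell>\<^sup>2\<close> norm bounded independently of \<open>N\<close>
  by the balance of the current, and its initial value is bounded by \<open>1 / Im z\<close>. By
  Montel's theorem the initial values converge along a subsequence, locally uniformly in \<open>z\<close>, so that the limit is
  holomorphic and yields a square summable solution.
\<close>

lemma weyl_function_exists:
  obtains m where "m holomorphic_on upper_half_plane"
    "\<And>z. Im z > 0 \<Longrightarrow> summable (\<lambda>n. (cmod (jacobi_solution a b z 1 (m z) n))\<^sup>2)"
proof -
  (* jacobi_solution a b z 1 (mm N z) vanishes at N + 2. *)
  define mm where "mm = (\<lambda>N z. - jacobi_solution a b z 1 0 (Suc (Suc N)) / f_minus a b (Suc (Suc N)) z)"
  define u where "u = (\<lambda>N z. jacobi_solution a b z 1 (mm N z))"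
  have hol: "mm N holomorphic_on upper_half_plane" for N
    unfolding mm_def f_minus_def
    using f_minus_nonzero[of _ "Suc (Suc N)"] a_nonzero unfolding f_minus_def
    by (intro holomorphic_intros holomorphic_jacobi_solution) (auto simp del: jacobi_solution.simps)
  have u_end: "u N z (Suc (Suc N)) = 0" if "Im z > 0" for N z
    using f_minus_nonzero[OF that, of "Suc (Suc N)"]
    unfolding u_def
    by (subst jacobi_solution_lincomb) (simp del: jacobi_solution.simps add: mm_def f_minus_def)
  have sol: "solves a b z (u N z)" for N z
    unfolding u_def by (rule solves_jacobi_solution)
  have sum_eq: "Im (mm N z) = - Im z * (\<Sum>k=1..Suc N. (cmod (u N z k))\<^sup>2)" if "Im z > 0" for N z
  proof -
    have "current a (u N z) (Suc N) = 0" by (simp add: current_def u_end[OF that])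
    moreover have "current a (u N z) 0 = Im (mm N z)" by (simp add: current_def a_0 u_def)
    ultimately show ?thesis using current_eq_sum[OF sol[of z N], of "Suc N"] by simp
  qed
  have bound: "cmod (mm N z) \<le> 1 / Im z" if "Im z > 0" for N z
  proof -
    have "(cmod (u N z 1))\<^sup>2 \<le> (\<Sum>k=1..Suc N. (cmod (u N z k))\<^sup>2)"
      by (rule member_le_sum) auto
    then have "Im z * (cmod (mm N z))\<^sup>2 \<le> - Im (mm N z)"
      using sum_eq[OF that, of N] that by (simp add: u_def)
    also have "\<dots> \<le> cmod (mm N z)" using abs_Im_le_cmod[of "mm N z"] by linarith
    finally have "Im z * cmod (mm N z) \<le> 1"
      by (cases "mm N z = 0") (auto simp: power2_eq_square)
    then show ?thesis using that by (simp add: field_simps)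
  qed
  have sum_bound: "(\<Sum>k=1..n. (cmod (u N z k))\<^sup>2) \<le> 1 / (Im z)\<^sup>2" if "Im z > 0" "n \<le> Suc N" for n N z
  proof -
    let ?S = "\<Sum>k=1..Suc N. (cmod (u N z k))\<^sup>2"
    have "Im z * ?S \<le> 1 / Im z"
      using sum_eq[OF that(1), of N] bound[OF that(1), of N] abs_Im_le_cmod[of "mm N z"] by linarith
    then have "?S \<le> (1 / Im z) / Im z"
      using that(1) by (simp only: pos_le_divide_eq mult.commute)
    moreover have "(\<Sum>k=1..n. (cmod (u N z k))\<^sup>2) \<le> ?S"
      using that(2) by (intro sum_mono2) auto
    ultimately show ?thesis by (simp add: power2_eq_square)
  qed
  obtain m r where m: "m holomorphic_on upper_half_plane" and r: "strict_mono (r :: nat \<Rightarrow> nat)"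
    and lim: "\<And>z. z \<in> upper_half_plane \<Longrightarrow> (\<lambda>n. mm (r n) z) \<longlonglongrightarrow> m z"
  proof (rule Montel[where \<F> = mm and S = upper_half_plane and \<H> = "range mm"])
    fix K assume K: "compact K" "K \<subseteq> upper_half_plane"
    obtain d where d: "d > 0" "\<And>z. z \<in> K \<Longrightarrow> d \<le> Im z"
      using compact_upper_half_plane_Im_bound[OF K] by blast
    have "cmod (mm N z) \<le> 1 / d" if "z \<in> K" for N z
    proof -
      have "1 / Im z \<le> 1 / d" using d(1) d(2)[OF that] by (simp add: frac_le)
      then show ?thesis using bound[of z N] d that by fastforce
    qed
    then show "\<exists>B. \<forall>h\<in>range mm. \<forall>z\<in>K. cmod (h z) \<le> B" by blast
  qed (use hol in auto)
  show ?thesis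
  proof (rule that[OF m])
    fix z assume z: "Im z > 0"
    let ?v = "jacobi_solution a b z 1 (m z)"
    have lim_u: "(\<lambda>j. u (r j) z n) \<longlonglongrightarrow> ?v n" for n
      unfolding u_def jacobi_solution_lincomb[of a b z 1 "mm _ z"]
        jacobi_solution_lincomb[of a b z 1 "m z"]
      using lim z by (intro tendsto_intros) auto
    have "(\<Sum>k=1..n. (cmod (?v k))\<^sup>2) \<le> 1 / (Im z)\<^sup>2" for n
    proof (rule LIMSEQ_le_const2)
      show "(\<lambda>j. \<Sum>k=1..n. (cmod (u (r j) z k))\<^sup>2) \<longlonglongrightarrow> (\<Sum>k=1..n. (cmod (?v k))\<^sup>2)"
        by (intro tendsto_intros lim_u)
      have "(\<Sum>k=1..n. (cmod (u (r j) z k))\<^sup>2) \<le> 1 / (Im z)\<^sup>2" if "j \<ge> n" for j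
        using seq_suble[OF r, of j] that by (intro sum_bound[OF z]) auto
      then show "\<exists>N. \<forall>j\<ge>N. (\<Sum>k=1..n. (cmod (u (r j) z k))\<^sup>2) \<le> 1 / (Im z)\<^sup>2" by blast
    qed
    then have *: "(\<Sum>k<n. (cmod (?v (Suc k)))\<^sup>2) \<le> 1 / (Im z)\<^sup>2" for n
      by (simp add: sum.atLeast1_atMost_eq)
    have "summable (\<lambda>k. (cmod (?v (Suc k)))\<^sup>2)"
      by (rule bounded_imp_summable[where B = "1 / (Im z)\<^sup>2"])
         (simp, simp only: lessThan_Suc_atMost[symmetric] *)
    then show "summable (\<lambda>k. (cmod (?v k))\<^sup>2)" by (subst (asm) summable_Suc_iff)
  qed
qed

text \<open>
  The column \<open>(J - z)\<^sup>-\<^sup>1 \<delta>\<^sub>n\<close> is glued at \<open>n\<close> from the solution vanishing at \<open>0\<close> and the square summable one; the jump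
  of the difference equation at \<open>n\<close> is their Wronskian, which is \<open>1\<close>.
\<close>

lemma green_eq_weyl_solution:
  assumes z: "Im z > 0" and sm: "summable (\<lambda>n. (cmod (jacobi_solution a b z 1 m n))\<^sup>2)" and "n \<ge> 1"
  shows "green a b n z = - f_minus a b n z * jacobi_solution a b z 1 m n"
proof -
  define p q where "p = (\<lambda>n. f_minus a b n z)" and "q = jacobi_solution a b z 1 m"
  have p: "solves a b z p" and q: "solves a b z q"
    unfolding p_def q_def by (rule solves_f_minus solves_jacobi_solution)+
  have W: "wronskian a p q k = 1" for k
    unfolding wronskian_const[OF p q, of k] by (simp add: wronskian_def p_def q_def a_0)
  define v where "v = (\<lambda>k. - p (min k n) * q (max k n))"
  obtain n' where n': "n = Suc n'" using \<open>n \<ge> 1\<close> by (cases n) auto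
  have "v \<in> ell2"
  proof -
    have "summable (\<lambda>k. (cmod (p n))\<^sup>2 * (cmod (q k))\<^sup>2)"
      using sm unfolding q_def by (rule summable_mult)
    then have "summable (\<lambda>k. (cmod (v k))\<^sup>2)"
      by (rule summable_comparison_test'[where N = n])
         (auto simp: v_def norm_mult power_mult_distrib min_def max_def)
    moreover have "v 0 = 0" by (simp add: v_def p_def)
    ultimately show ?thesis by (simp add: ell2_def)
  qed
  moreover have "jacobi a b v k - z * v k = delta n k" for k
  proof (cases k)
    case 0
    then show ?thesis using \<open>v \<in> ell2\<close> n' by (simp add: jacobi_def delta_def ell2_def)
  next
    case (Suc l)
    have pl: "of_real (a k) * p (Suc k) = z * p k - of_real (a l) * p l - of_real (b k) * p k"
      and ql: "of_real (a k) * q (Suc k) = z * q k - of_real (a l) * q l - of_real (b k) * q k"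
      using p q Suc unfolding solves_def by (auto simp: algebra_simps)
    have "v 0 = 0" by (simp add: v_def p_def)
    then have J: "jacobi a b v k = of_real (a k) * v (Suc k) + of_real (a l) * v l + of_real (b k) * v k"
      using Suc by (auto simp: jacobi_def)
    consider "k < n" | "k = n" | "k > n" by linarith
    then show ?thesis
    proof cases
      case 1
      then have v: "v (Suc k) = - p (Suc k) * q n" "v k = - p k * q n" "v l = - p l * q n"
        using Suc by (simp_all add: v_def)
      have "jacobi a b v k - z * v k = - (of_real (a k) * p (Suc k)) * q n - of_real (a l) * p l * q n
          - of_real (b k) * p k * q n + z * p k * q n"
        unfolding J v by (simp add: algebra_simps)
      then show ?thesis using 1 unfolding pl by (simp add: algebra_simps delta_def)
    next
      case 2
      then have v: "v (Suc k) = - p k * q (Suc k)" "v k = - p k * q k" "v l = - p l * q k"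
        using Suc by (simp_all add: v_def)
      have "jacobi a b v k - z * v k = - p k * (of_real (a k) * q (Suc k)) +
          (z * p k - of_real (a l) * p l - of_real (b k) * p k) * q k"
        unfolding J v by (simp add: algebra_simps)
      also have "\<dots> = wronskian a p q k"
        unfolding pl[symmetric] by (simp add: wronskian_def algebra_simps)
      finally show ?thesis using 2 W by (simp add: delta_def)
    next
      case 3
      then have v: "v (Suc k) = - p n * q (Suc k)" "v k = - p n * q k" "v l = - p n * q l"
        using Suc by (simp_all add: v_def)
      have "jacobi a b v k - z * v k = - p n * (of_real (a k) * q (Suc k)) - p n * of_real (a l) * q l
          - of_real (b k) * p n * q k + z * p n * q k"
        unfolding J v by (simp add: algebra_simps)
      then show ?thesis using 3 unfolding ql by (simp add: algebra_simps delta_def)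
    qed
  qed
  ultimately have "jacobi_resolvent a b z (delta n) = v" by (intro jacobi_resolvent_eqI z)
  then show ?thesis by (simp add: green_def delta_inner v_def p_def q_def)
qed

text \<open>
  For \<open>n = 1\<close> the formula for the Green function identifies the initial value in the definition of \<^const>\<open>f_plus\<close> with that of the Weyl solution.
\<close>

lemma green_1_holomorphic: "green a b 1 holomorphic_on upper_half_plane"
  and f_plus_square_summable: "Im z > 0 \<Longrightarrow> summable (\<lambda>n. (cmod (f_plus a b n z))\<^sup>2)"
  and green_eq: "Im z > 0 \<Longrightarrow> n \<ge> 1 \<Longrightarrow> green a b n z = - f_minus a b n z * f_plus a b n z"
proof -
  obtain m where m: "m holomorphic_on upper_half_plane"
    and sm: "\<And>z. Im z > 0 \<Longrightarrow> summable (\<lambda>n. (cmod (jacobi_solution a b z 1 (m z) n))\<^sup>2)"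
    by (rule weyl_function_exists) blast
  have g1: "green a b 1 z = - m z" if "Im z > 0" for z
    using green_eq_weyl_solution[OF that sm[OF that], of 1] by (simp add: f_minus_def)
  have "(\<lambda>z. - m z) holomorphic_on upper_half_plane" using m by (intro holomorphic_intros)
  then show "green a b 1 holomorphic_on upper_half_plane"
    by (rule holomorphic_transform) (simp add: g1 del: One_nat_def)
  have fp: "f_plus a b n z = jacobi_solution a b z 1 (m z) n" if "Im z > 0" for n z
    unfolding f_plus_def g1[OF that] by simp
  show "summable (\<lambda>n. (cmod (f_plus a b n z))\<^sup>2)" if "Im z > 0"
    using sm[OF that] by (simp add: fp[OF that])
  show "green a b n z = - f_minus a b n z * f_plus a b n z" if "Im z > 0" "n \<ge> 1"
    using green_eq_weyl_solution[OF that(1) sm[OF that(1)] that(2)] by (simp add: fp[OF that(1)])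
qed

lemma f_plus_holomorphic: "f_plus a b n holomorphic_on upper_half_plane"
  unfolding f_plus_def using green_1_holomorphic a_nonzero
  by (intro holomorphic_jacobi_solution holomorphic_intros) auto

lemma solves_f_plus: "solves a b z (\<lambda>n. f_plus a b n z)"
  unfolding f_plus_def by (rule solves_jacobi_solution)

lemma f_plus_0 [simp]: "f_plus a b 0 z = 1"
  by (simp add: f_plus_def)

lemma current_f_plus_neg: "Im z > 0 \<Longrightarrow> current a (\<lambda>n. f_plus a b n z) n < 0"
  using square_summable_tendsto_0[OF f_plus_square_summable[of z]]
  by (intro current_neg[OF solves_f_plus]) auto

lemma f_plus_nonzero: "Im z > 0 \<Longrightarrow> f_plus a b n z \<noteq> 0"
  using current_f_plus_neg[of z n] by (auto simp: current_def)

lemma f_plus_quotient: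
  assumes "Im z > 0" shows "Im (- (f_plus a b (Suc n) z / f_plus a b n z)) > 0"
proof -
  have "Im (f_plus a b (Suc n) z / f_plus a b n z) < 0"
    unfolding Im_quotient_eq_current[of "\<lambda>n. f_plus a b n z"]
    using current_f_plus_neg[OF assms, of n] a_pos[of n] f_plus_nonzero[OF assms, of n]
    by (intro divide_neg_pos) auto
  then show ?thesis by simp
qed

end

section \<open>The derivative of the averaged logarithms\<close>

context jacobi_coefficients
begin

definition f_plus' :: "nat \<Rightarrow> complex \<Rightarrow> complex" where
  "f_plus' n z = deriv (f_plus a b n) z"

lemma f_plus_has_deriv:
  "Im z > 0 \<Longrightarrow> (f_plus a b n has_field_derivative f_plus' n z) (at z)"
  unfolding f_plus'_def using f_plus_holomorphic
  by (intro holomorphic_derivI[of _ upper_half_plane]) auto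

lemma f_plus'_0: "f_plus' 0 z = 0"
proof -
  have "f_plus a b 0 = (\<lambda>_. 1)" by auto
  then show ?thesis unfolding f_plus'_def by simp
qed

lemma f_plus'_rec:
  assumes "Im z > 0"
  shows "of_real (a (Suc n)) * f_plus' (Suc (Suc n)) z + of_real (a n) * f_plus' n z
      + of_real (b (Suc n)) * f_plus' (Suc n) z = z * f_plus' (Suc n) z + f_plus a b (Suc n) z"
proof -
  have eq: "f_plus a b (Suc (Suc n)) = (\<lambda>z. ((z - of_real (b (Suc n))) * f_plus a b (Suc n) z
      - of_real (a n) * f_plus a b n z) / of_real (a (Suc n)))"
    by (simp add: f_plus_def fun_eq_iff)
  have "(f_plus a b (Suc (Suc n)) has_field_derivative
     (f_plus a b (Suc n) z + (z - of_real (b (Suc n))) * f_plus' (Suc n) z - of_real (a n) * f_plus' n z)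
       / of_real (a (Suc n))) (at z)"
    unfolding eq using a_nonzero[of "Suc n"]
    by (auto intro!: derivative_eq_intros f_plus_has_deriv assms simp: field_simps)
  then have "f_plus' (Suc (Suc n)) z =
     (f_plus a b (Suc n) z + (z - of_real (b (Suc n))) * f_plus' (Suc n) z - of_real (a n) * f_plus' n z)
       / of_real (a (Suc n))"
    unfolding f_plus'_def[of "Suc (Suc n)"] by (rule DERIV_imp_deriv)
  then show ?thesis using a_nonzero[of "Suc n"] by (simp add: field_simps)
qed

text \<open>
  Differentiating the difference equation in \<open>z\<close> shows that \<open>\<partial>f\<^sub>+/\<partial>z\<close> solves it with the inhomogeneity \<open>f\<^sub>+\<close>. Its Wronskian
  with \<open>f\<^sub>-\<close> therefore grows by \<open>- f\<^sub>- f\<^sub>+\<close>, the diagonal Green function, in each step; it starts at zero because \<open>f\<^sub>+(0) = 1\<close> for all \<open>z\<close>.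
\<close>

lemma sum_green:
  assumes z: "Im z > 0"
  shows "(\<Sum>n=1..N. green a b n z) = wronskian a (\<lambda>n. f_minus a b n z) (\<lambda>n. f_plus' n z) N"
proof (induction N)
  case 0
  then show ?case by (simp add: wronskian_def f_plus'_0)
next
  case (Suc N)
  define p k where "p = (\<lambda>n. f_minus a b n z)" and "k = (\<lambda>n. f_plus' n z)"
  have p: "of_real (a (Suc N)) * p (Suc (Suc N)) = z * p (Suc N) - of_real (a N) * p N
      - of_real (b (Suc N)) * p (Suc N)"
    using solves_f_minus[of z, unfolded solves_def, THEN spec[of _ N]]
    by (simp add: algebra_simps p_def)
  have k: "of_real (a (Suc N)) * k (Suc (Suc N)) = z * k (Suc N) + f_plus a b (Suc N) z
      - of_real (a N) * k N - of_real (b (Suc N)) * k (Suc N)"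
    using f_plus'_rec[OF z, of N] by (simp add: algebra_simps k_def)
  have "wronskian a p k (Suc N) = (of_real (a (Suc N)) * p (Suc (Suc N))) * k (Suc N)
      - p (Suc N) * (of_real (a (Suc N)) * k (Suc (Suc N)))"
    by (simp add: wronskian_def algebra_simps)
  also have "\<dots> = wronskian a p k N - p (Suc N) * f_plus a b (Suc N) z"
    unfolding p k wronskian_def by (simp add: algebra_simps)
  finally show ?case
    using Suc green_eq[OF z, of "Suc N"] by (simp add: p_def k_def)
qed

abbreviation m_plus :: "nat \<Rightarrow> complex \<Rightarrow> complex" where
  "m_plus n z \<equiv> - (f_plus a b (Suc n) z / f_plus a b n z)"

lemma m_plus_holomorphic: "m_plus n holomorphic_on upper_half_plane"
  using f_plus_nonzero f_plus_holomorphic by (intro holomorphic_intros) auto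

lemma deriv_m_plus:
  assumes "Im z > 0"
  shows "(m_plus n has_field_derivative
    m_plus n z * (f_plus' (Suc n) z / f_plus a b (Suc n) z - f_plus' n z / f_plus a b n z)) (at z)"
proof -
  let ?f = "f_plus a b (Suc n) z" and ?g = "f_plus a b n z"
  have nz: "?f \<noteq> 0" "?g \<noteq> 0" using f_plus_nonzero[OF assms] by auto
  have "(m_plus n has_field_derivative
      - ((f_plus' (Suc n) z * ?g - ?f * f_plus' n z) / (?g * ?g))) (at z)"
    by (intro DERIV_minus DERIV_divide f_plus_has_deriv assms nz)
  moreover have "- ((f_plus' (Suc n) z * ?g - ?f * f_plus' n z) / (?g * ?g))
      = - (?f / ?g) * (f_plus' (Suc n) z / ?f - f_plus' n z / ?g)"
    using nz by (simp add: field_simps)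
  ultimately show ?thesis by simp
qed

text \<open>
  Adding \<open>w\<close> keeps the imaginary part of the denominator at least \<open>Im m\<^sub>+\<close>, and the derivative of a Herglotz
  function is at most a multiple of its imaginary part. The bound does not depend on \<open>n\<close>.
\<close>

lemma deriv_m_plus_bound:
  assumes "Im z > 0" "Im w \<ge> 0"
  shows "cmod (deriv (m_plus n) z / (m_plus n z + w)) \<le> 2 / Im z"
proof -
  define m where "m = m_plus n z"
  have m: "Im m > 0" using f_plus_quotient[OF assms(1)] unfolding m_def .
  have "Im m \<le> cmod (m + w)"
    using abs_Im_le_cmod[of "m + w"] assms(2) m unfolding plus_complex.sel by linarith
  moreover have "cmod (deriv (m_plus n) z) \<le> 2 * Im m / Im z"
    unfolding m_def by (rule herglotz_deriv_bound[OF m_plus_holomorphic f_plus_quotient assms(1)])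
  ultimately have "cmod (deriv (m_plus n) z) / cmod (m + w) \<le> (2 * Im m / Im z) / Im m"
    using m assms(1) by (intro frac_le) auto
  also have "\<dots> = 2 / Im z" using m by simp
  finally show ?thesis unfolding m_def by (simp only: norm_divide)
qed

text \<open>
  The identity behind \<open>sum_green_eq\<close>, where \<open>p\<close>, \<open>q\<close>, \<open>k\<close> stand for the values of \<open>f\<^sub>-\<close>, \<open>f\<^sub>+\<close>, \<open>\<partial>f\<^sub>+/\<partial>z\<close>
  at \<open>N\<close> and the primed letters for those at \<open>N + 1\<close>. The Wronskian of \<open>f\<^sub>-\<close> and \<open>f\<^sub>+\<close> is \<open>1\<close>, which makes \<open>D = 1 / a N\<close>.
\<close>

lemma green_sum_algebra:
  fixes p p' q q' k k' D :: complex
  assumes "p \<noteq> 0" "q \<noteq> 0" "q' \<noteq> 0" "D \<noteq> 0" and D: "D = p' * q - p * q'"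
  shows "(p' * k - p * k') / D = k / q + (- (q' / q) * (k' / q' - k / q)) / (D / (p * q))"
proof -
  have A: "k / q = (k * p' - k * p * q' / q) / D"
    using assms(2,4) unfolding D by (simp add: field_simps)
  have B: "(- (q' / q) * (k' / q' - k / q)) / (D / (p * q)) = (k * p * q' / q - p * k') / D"
    using assms(1-4) by (simp add: field_simps)
  show ?thesis unfolding B unfolding A by (simp add: add_divide_distrib[symmetric] algebra_simps)
qed

text \<open>
  Writing \<open>\<partial>f\<^sub>+/\<partial>z\<close> as \<open>f\<^sub>+\<close> times its logarithmic derivative turns the Wronskian of \<open>sum_green\<close> into the logarithmic
  derivative at \<open>N\<close> and a remainder of the form estimated in \<open>deriv_m_plus_bound\<close>.
\<close>

lemma sum_green_eq:
  assumes z: "Im z > 0" and N: "N \<ge> 1"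
  shows "(\<Sum>n=1..N. green a b n z) = f_plus' N z / f_plus a b N z
    + deriv (m_plus N) z / (m_plus N z + f_minus a b (Suc N) z / f_minus a b N z)"
proof -
  define p q k where "p = (\<lambda>n. f_minus a b n z)" and "q = (\<lambda>n. f_plus a b n z)"
    and "k = (\<lambda>n. f_plus' n z)"
  have nz: "p N \<noteq> 0" "q N \<noteq> 0" "q (Suc N) \<noteq> 0"
    using f_minus_nonzero[OF z N] f_plus_nonzero[OF z] by (simp_all add: p_def q_def)
  have "wronskian a p q N = 1"
    using wronskian_const[OF solves_f_minus[of z] solves_f_plus[of z], of N]
    by (simp add: wronskian_def p_def q_def a_0)
  then have W: "of_real (a N) * (p (Suc N) * q N - p N * q (Suc N)) = 1"
    by (simp add: wronskian_def)
  then have D: "p (Suc N) * q N - p N * q (Suc N) \<noteq> 0" by auto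
  have aN: "of_real (a N) = 1 / (p (Suc N) * q N - p N * q (Suc N))"
    using W D by (simp add: field_simps)
  have "deriv (m_plus N) z = - (q (Suc N) / q N) * (k (Suc N) / q (Suc N) - k N / q N)"
    using DERIV_imp_deriv[OF deriv_m_plus[OF z, of N]] by (simp add: q_def k_def)
  moreover have "m_plus N z + f_minus a b (Suc N) z / f_minus a b N z
      = (p (Suc N) * q N - p N * q (Suc N)) / (p N * q N)"
    using nz by (simp add: p_def q_def field_simps)
  moreover have "wronskian a p k N = (p (Suc N) * k N - p N * k (Suc N)) / (p (Suc N) * q N - p N * q (Suc N))"
    unfolding wronskian_def aN by simp
  moreover note green_sum_algebra[OF nz D refl, of "k N" "k (Suc N)"]
  ultimately show ?thesis
    using sum_green[OF z, of N] D by (simp add: p_def q_def k_def)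
qed

text \<open>
  The sum of the logarithmic derivatives of quotients of neighbouring values telescopes.
\<close>

lemma deriv_w_plus_avg:
  assumes z: "Im z > 0"
  shows "(w_plus_avg a b N has_field_derivative
    (1 / of_nat N) * (f_plus' (Suc N) z / f_plus a b (Suc N) z - f_plus' 1 z / f_plus a b 1 z)) (at z)"
proof -
  define l where "l = (\<lambda>n. f_plus' n z / f_plus a b n z)"
  have D: "((\<lambda>z. Ln (m_plus n z)) has_field_derivative l (Suc n) - l n) (at z)" for n
  proof -
    have m: "Im (m_plus n z) > 0" using f_plus_quotient[OF z] .
    then have "m_plus n z \<notin> \<real>\<^sub>\<le>\<^sub>0" "m_plus n z \<noteq> 0" by (auto simp: complex_nonpos_Reals_iff)
    have "((\<lambda>z. Ln (m_plus n z)) has_field_derivative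
        inverse (m_plus n z) * (m_plus n z * (l (Suc n) - l n))) (at z)"
      using DERIV_chain2[OF has_field_derivative_Ln[OF \<open>m_plus n z \<notin> \<real>\<^sub>\<le>\<^sub>0\<close>] deriv_m_plus[OF z]]
      unfolding l_def .
    moreover have "inverse (m_plus n z) * (m_plus n z * (l (Suc n) - l n)) = l (Suc n) - l n"
      using \<open>m_plus n z \<noteq> 0\<close> by (metis left_inverse mult.assoc mult_1)
    ultimately show ?thesis by simp
  qed
  have "((\<lambda>z. (1 / of_nat N) * (\<Sum>n=1..N. Ln (m_plus n z))) has_field_derivative
      (1 / of_nat N) * (\<Sum>n=1..N. l (Suc n) - l n)) (at z)"
    by (intro DERIV_cmult DERIV_sum D)
  moreover have "(\<Sum>n=1..N. l (Suc n) - l n) = l (Suc N) - l 1"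
    by (rule sum_Suc_diff) simp
  ultimately show ?thesis unfolding l_def w_plus_avg_def[abs_def] by simp
qed

lemma w_plus_avg_holomorphic: "w_plus_avg a b N holomorphic_on upper_half_plane"
  unfolding holomorphic_on_open[OF open_upper_half_plane]
  by (intro ballI exI, rule deriv_w_plus_avg) simp

text \<open>
  One remainder \<open>2 / Im z\<close> comes from the sum of the Green functions, the other from replacing the logarithmic
  derivative at \<open>N + 1\<close> by that at \<open>N\<close>; their difference is the logarithmic derivative of \<open>m\<^sub>+\<close>.
\<close>

lemma deriv_w_plus_avg_green_avg:
  assumes z: "Im z > 0" and N: "N \<ge> 1"
  shows "cmod (deriv (w_plus_avg a b N) z - green_avg a b N z)
    \<le> (4 / Im z + cmod (f_plus' 1 z / f_plus a b 1 z)) / N"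
proof -
  define l where "l = (\<lambda>n. f_plus' n z / f_plus a b n z)"
  define e where "e = deriv (m_plus N) z / (m_plus N z + f_minus a b (Suc N) z / f_minus a b N z)"
  have m: "m_plus N z \<noteq> 0" using f_plus_quotient[OF z, of N] by auto
  have l: "deriv (m_plus N) z / (m_plus N z + 0) = l (Suc N) - l N"
    using DERIV_imp_deriv[OF deriv_m_plus[OF z, of N]] m unfolding l_def
    by (simp only: add_0_right nonzero_mult_div_cancel_left not_False_eq_True)
  have "deriv (w_plus_avg a b N) z - green_avg a b N z
      = (1 / of_nat N) * ((l (Suc N) - l 1) - (l N + e))"
    unfolding green_avg_def sum_green_eq[OF z N] DERIV_imp_deriv[OF deriv_w_plus_avg[OF z]]
    by (simp add: l_def e_def right_diff_distrib)
  also have "(l (Suc N) - l 1) - (l N + e) = (l (Suc N) - l N) - l 1 - e" by simp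
  finally have "cmod (deriv (w_plus_avg a b N) z - green_avg a b N z)
      = cmod ((l (Suc N) - l N) - l 1 - e) / N"
    by (simp only: norm_mult norm_divide norm_one norm_of_nat times_divide_eq_left mult_1)
  moreover have "cmod ((l (Suc N) - l N) - l 1 - e) \<le> cmod (l (Suc N) - l N) + cmod (l 1) + cmod e"
    by (rule order_trans[OF norm_triangle_ineq4 add_right_mono[OF norm_triangle_ineq4]])
  moreover have "cmod (l (Suc N) - l N) \<le> 2 / Im z"
    unfolding l[symmetric] by (rule deriv_m_plus_bound[OF z]) simp
  moreover have "cmod e \<le> 2 / Im z"
    unfolding e_def using f_minus_quotient[OF z N] by (intro deriv_m_plus_bound[OF z]) simp
  ultimately have "cmod (deriv (w_plus_avg a b N) z - green_avg a b N z)
      \<le> (4 / Im z + cmod (l 1)) / N"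
    by (simp only:) (intro divide_right_mono, linarith, simp)
  then show ?thesis unfolding l_def .
qed

lemma deriv_w_plus_limit:
  assumes N: "filterlim N at_top sequentially"
    and w: "loc_unif_limit (\<lambda>j. w_plus_avg a b (N j)) w"
    and g: "loc_unif_limit (\<lambda>j. green_avg a b (N j)) g"
    and z: "Im z > 0"
  shows "(w has_field_derivative g z) (at z)"
proof -
  have zU: "z \<in> upper_half_plane" using z by simp
  have ulim: "\<exists>d>0. cball x d \<subseteq> upper_half_plane \<and>
      uniform_limit (cball x d) (\<lambda>j. w_plus_avg a b (N j)) w sequentially"
    if x: "x \<in> upper_half_plane" for x
  proof -
    obtain d where "d > 0" "cball x d \<subseteq> upper_half_plane"
      using bspec[OF open_upper_half_plane[unfolded open_contains_cball] x] by blast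
    moreover from this have "uniform_limit (cball x d) (\<lambda>j. w_plus_avg a b (N j)) w sequentially"
      by (intro w[unfolded loc_unif_limit_def, rule_format]) simp
    ultimately show ?thesis by (intro exI conjI)
  qed
  have hol: "w holomorphic_on upper_half_plane"
    by (rule holomorphic_uniform_sequence[OF open_upper_half_plane w_plus_avg_holomorphic ulim])
  have dw: "(w_plus_avg a b (N j) has_field_derivative deriv (w_plus_avg a b (N j)) x) (at x)"
    if "x \<in> upper_half_plane" for j x
    using w_plus_avg_holomorphic that by (intro holomorphic_derivI[of _ upper_half_plane]) auto
  obtain w' where w': "\<And>x. x \<in> upper_half_plane \<Longrightarrow>
      (w has_field_derivative w' x) (at x) \<and>
      (\<lambda>j. deriv (w_plus_avg a b (N j)) x) \<longlonglongrightarrow> w' x"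
    using has_complex_derivative_uniform_sequence[OF open_upper_half_plane dw ulim]
    by (auto simp del: upper_half_plane_iff)
  have "uniform_limit {z} (\<lambda>j. green_avg a b (N j)) g sequentially"
    by (rule g[unfolded loc_unif_limit_def, rule_format]) (simp add: z)
  then have green: "(\<lambda>j. green_avg a b (N j) z) \<longlonglongrightarrow> g z"
    by (rule tendsto_uniform_limitI) simp
  have diff: "(\<lambda>j. deriv (w_plus_avg a b (N j)) z - green_avg a b (N j) z) \<longlonglongrightarrow> 0"
  proof (rule Lim_null_comparison)
    show "\<forall>\<^sub>F j in sequentially. cmod (deriv (w_plus_avg a b (N j)) z - green_avg a b (N j) z)
        \<le> (4 / Im z + cmod (f_plus' 1 z / f_plus a b 1 z)) / real (N j)"
      using filterlim_at_top[THEN iffD1, OF N, rule_format, of 1]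
      by eventually_elim (rule deriv_w_plus_avg_green_avg[OF z])
    show "(\<lambda>j. (4 / Im z + cmod (f_plus' 1 z / f_plus a b 1 z)) / real (N j)) \<longlonglongrightarrow> 0"
      by (rule real_tendsto_divide_at_top[OF tendsto_const])
         (rule filterlim_compose[OF filterlim_real_sequentially N])
  qed
  have "(\<lambda>j. deriv (w_plus_avg a b (N j)) z) \<longlonglongrightarrow> g z"
    using tendsto_add[OF diff green] by simp
  moreover have "(\<lambda>j. deriv (w_plus_avg a b (N j)) z) \<longlonglongrightarrow> w' z" using w'[OF zU] by blast
  ultimately have "w' z = g z" by (rule LIMSEQ_unique[rotated])
  then show ?thesis using w'[OF zU] by simp
qed

end

section \<open>Almost everywhere differentiability of Lipschitz functions\<close>

text \<open>
  The intervals around a point \<open>t\<close> need not be centred at \<open>t\<close>, which is what secant slopes call for.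
\<close>

lemma Vitali_covering_intervals:
  fixes S :: "real set" and K :: "(real \<times> real) set"
  assumes K: "\<And>u v. (u, v) \<in> K \<Longrightarrow> u < v"
    and S: "\<And>t d. t \<in> S \<Longrightarrow> d > 0 \<Longrightarrow> \<exists>u v. (u, v) \<in> K \<and> u \<le> t \<and> t \<le> v \<and> v - u < d"
  obtains C where "countable C" "C \<subseteq> K" "disjoint_family_on (\<lambda>(u, v). {u..v}) C"
    "negligible (S - (\<Union>(u, v)\<in>C. {u..v}))"
proof -
  have cb: "cball ((fst i + snd i) / 2) ((snd i - fst i) / 2) = {fst i..snd i}" for i :: "real \<times> real"
    by (simp add: cball_eq_atLeastAtMost field_simps)
  obtain C where C: "countable C" "C \<subseteq> K"
    and disj: "pairwise (\<lambda>i j. disjnt (cball ((fst i + snd i) / 2) ((snd i - fst i) / 2))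
        (cball ((fst j + snd j) / 2) ((snd j - fst j) / 2))) C"
    and neg: "negligible (S - (\<Union>i\<in>C. cball ((fst i + snd i) / 2) ((snd i - fst i) / 2)))"
  proof (rule Vitali_covering_theorem_cballs[where K = K and S = S
      and r = "\<lambda>i. (snd i - fst i) / 2" and a = "\<lambda>i. (fst i + snd i) / 2"])
    show "0 < (snd i - fst i) / 2" if "i \<in> K" for i
      using K[of "fst i" "snd i"] that by simp
    show "\<exists>i. i \<in> K \<and> t \<in> cball ((fst i + snd i) / 2) ((snd i - fst i) / 2) \<and> (snd i - fst i) / 2 < d"
      if t: "t \<in> S" "0 < d" for t d
    proof -
      obtain u v where uv: "(u, v) \<in> K" "u \<le> t" "t \<le> v" "v - u < d" using S[OF t] by blast
      then show ?thesis unfolding cb using K[OF uv(1)] by (intro exI[of _ "(u, v)"]) auto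
    qed
  qed auto
  show ?thesis
    by (rule that[OF C])
       (use disj neg in \<open>auto simp: cb case_prod_beta disjoint_family_on_def pairwise_def disjnt_def\<close>)
qed

lemma emeasure_disjoint_Union_le:
  assumes "countable C" "disjoint_family_on X C" "sets M = sets N"
    and "\<And>i. i \<in> C \<Longrightarrow> X i \<in> sets N" "\<And>i. i \<in> C \<Longrightarrow> emeasure M (X i) \<le> c * emeasure N (X i)"
  shows "emeasure M (\<Union>i\<in>C. X i) \<le> c * emeasure N (\<Union>i\<in>C. X i)"
proof -
  have "emeasure M (\<Union>i\<in>C. X i) = (\<integral>\<^sup>+i. emeasure M (X i) \<partial>count_space C)"
    using assms by (intro emeasure_UN_countable) auto
  also have "\<dots> \<le> (\<integral>\<^sup>+i. c * emeasure N (X i) \<partial>count_space C)"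
    using assms(5) by (intro nn_integral_mono) auto
  also have "\<dots> = c * (\<integral>\<^sup>+i. emeasure N (X i) \<partial>count_space C)"
    by (rule nn_integral_cmult) auto
  also have "(\<integral>\<^sup>+i. emeasure N (X i) \<partial>count_space C) = emeasure N (\<Union>i\<in>C. X i)"
    using assms by (intro emeasure_UN_countable[symmetric]) auto
  finally show ?thesis .
qed

lemma countable_imp_negligible: "countable A \<Longrightarrow> negligible (A :: real set)"
  unfolding negligible_iff_null_sets
  by (rule null_sets_completionI) (rule countable_imp_null_set_lborel)

text \<open>
  Let \<open>\<mu>\<close> be the Stieltjes measure of \<open>f\<close>. Up to null sets, cover \<open>S\<close> by disjoint intervals of slope less than \<open>p\<close>
  inside an open set \<open>U\<close> barely larger than \<open>S\<close>, and then, inside these, by disjoint intervals of slope more than \<open>q\<close>. The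
  \<open>\<mu>\<close>-measure of the second cover is at least \<open>q\<close> times the outer measure of \<open>S\<close> and at most \<open>p\<close> times the measure of
  \<open>U\<close>. As \<open>S\<close> need not be measurable, its outer measure \<open>m\<close> is taken as an infimum over open sets.
\<close>

lemma negligible_slope_gap:
  fixes f :: "real \<Rightarrow> real" and p q :: real
  assumes mono: "\<And>x y. x \<le> y \<Longrightarrow> f x \<le> f y" and cont: "continuous_on UNIV f"
    and pq: "p < q" and bdd: "bounded S"
    and low: "\<And>t d. t \<in> S \<Longrightarrow> d > 0 \<Longrightarrow>
      \<exists>u v. u < v \<and> u \<le> t \<and> t \<le> v \<and> v - u < d \<and> f v - f u < p * (v - u)"
    and high: "\<And>t d. t \<in> S \<Longrightarrow> d > 0 \<Longrightarrow>
      \<exists>u v. u < v \<and> u \<le> t \<and> t \<le> v \<and> v - u < d \<and> f v - f u > q * (v - u)"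
  shows "negligible S"
proof (cases "S = {}")
  case False
  then obtain t0 where "t0 \<in> S" by blast
  from low[OF this, of 1] obtain u v where "u < v" "f v - f u < p * (v - u)" by auto
  then have p: "p > 0" using mono[of u v]
    by (metis diff_ge_0_iff_ge diff_gt_0_iff_gt less_eq_real_def order.strict_trans1 zero_less_mult_pos2)
  define \<mu> where "\<mu> = interval_measure f"
  have sets: "sets \<mu> = sets lborel" by (simp add: \<mu>_def)
  have \<mu>: "emeasure \<mu> {u..v} = ennreal (f v - f u)" if "u \<le> v" for u v
    unfolding \<mu>_def using emeasure_interval_measure_Icc[OF that mono cont] .
  define \<U> where "\<U> = {U. open U \<and> U \<in> lmeasurable \<and> S \<subseteq> U}"
  define m where "m = Inf (measure lebesgue ` \<U>)"
  have m_le: "m \<le> measure lebesgue U" if "U \<in> \<U>" for U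
    unfolding m_def using that by (intro cInf_lower) (auto intro: bdd_belowI[of _ 0])
  obtain R where R: "S \<subseteq> ball 0 R" using bdd bounded_subset_ballD by blast
  then have "ball 0 R \<in> \<U>" by (auto simp: \<U>_def)
  then have m0: "m \<ge> 0" unfolding m_def by (intro cInf_greatest) auto
  have le: "q * m \<le> p * (m + e)" if e: "e > 0" for e
  proof -
    have "\<exists>x\<in>measure lebesgue ` \<U>. x < m + e"
      using \<open>ball 0 R \<in> \<U>\<close> e unfolding m_def by (intro cInf_lessD) auto
    then obtain U where U: "open U" "U \<in> lmeasurable" "S \<subseteq> U" "measure lebesgue U < m + e"
      by (auto simp: \<U>_def)
    define K1 where "K1 = {(u, v). u < v \<and> {u..v} \<subseteq> U \<and> f v - f u < p * (v - u)}"
    obtain C1 where C1: "countable C1" "C1 \<subseteq> K1" "disjoint_family_on (\<lambda>(u, v). {u..v}) C1"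
      "negligible (S - (\<Union>(u, v)\<in>C1. {u..v}))"
    proof (rule Vitali_covering_intervals[of K1 S])
      fix t d :: real assume t: "t \<in> S" "d > 0"
      then obtain r where r: "r > 0" "ball t r \<subseteq> U" using U(1,3) open_contains_ball by blast
      obtain u v where uv: "u < v" "u \<le> t" "t \<le> v" "v - u < min d r" "f v - f u < p * (v - u)"
        using low[OF t(1), of "min d r"] t r by auto
      then have "{u..v} \<subseteq> ball t r" by (auto simp: dist_real_def)
      then show "\<exists>u v. (u, v) \<in> K1 \<and> u \<le> t \<and> t \<le> v \<and> v - u < d"
        using uv r unfolding K1_def by (intro exI[of _ u] exI[of _ v]) auto
    qed (auto simp: K1_def)
    (* The open intervals still cover S up to a null set, and the second covering
       needs room around each point. *)
    define V where "V = (\<Union>(u, v)\<in>C1. {u<..<v})"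
    have "open V" unfolding V_def by auto
    have neg1: "negligible (S - V)"
    proof (rule negligible_subset)
      show "negligible ((S - (\<Union>(u, v)\<in>C1. {u..v})) \<union> (fst ` C1 \<union> snd ` C1))"
        using C1(1) by (intro negligible_Un C1(4) countable_imp_negligible countable_image)
      show "S - V \<subseteq> (S - (\<Union>(u, v)\<in>C1. {u..v})) \<union> (fst ` C1 \<union> snd ` C1)"
        unfolding V_def by force
    qed
    define K2 where "K2 = {(u, v). u < v \<and> {u..v} \<subseteq> V \<and> f v - f u > q * (v - u)}"
    obtain C2 where C2: "countable C2" "C2 \<subseteq> K2" "disjoint_family_on (\<lambda>(u, v). {u..v}) C2"
      "negligible (S \<inter> V - (\<Union>(u, v)\<in>C2. {u..v}))"
    proof (rule Vitali_covering_intervals[of K2 "S \<inter> V"])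
      fix t d :: real assume t: "t \<in> S \<inter> V" "d > 0"
      then obtain r where r: "r > 0" "ball t r \<subseteq> V" using \<open>open V\<close> open_contains_ball by blast
      obtain u v where uv: "u < v" "u \<le> t" "t \<le> v" "v - u < min d r" "f v - f u > q * (v - u)"
        using high[of t "min d r"] t r by auto
      then have "{u..v} \<subseteq> ball t r" by (auto simp: dist_real_def)
      then show "\<exists>u v. (u, v) \<in> K2 \<and> u \<le> t \<and> t \<le> v \<and> v - u < d"
        using uv r unfolding K2_def by (intro exI[of _ u] exI[of _ v]) auto
    qed (auto simp: K2_def)
    define I J where "I = (\<Union>i\<in>C1. case i of (u, v) \<Rightarrow> {u..v})"
      and "J = (\<Union>i\<in>C2. case i of (u, v) \<Rightarrow> {u..v})"
    have IJ: "I \<in> sets borel" "J \<in> sets borel" unfolding I_def J_def using C1(1) C2(1)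
      by (auto intro!: sets.countable_UN' simp: case_prod_beta)
    have "I \<subseteq> U" using C1(2) unfolding I_def K1_def by auto
    have "J \<subseteq> V" using C2(2) unfolding J_def K2_def by auto
    have "V \<subseteq> I" 
      unfolding V_def I_def by (intro UN_mono order_refl) (auto simp: case_prod_beta)
    have 1: "emeasure \<mu> I \<le> ennreal p * emeasure lborel I"
      unfolding I_def
    proof (rule emeasure_disjoint_Union_le[OF C1(1,3) sets])
      fix i assume i: "i \<in> C1"
      obtain u v where uv: "i = (u, v)" by (cases i)
      with i C1(2) have "u < v" "f v - f u < p * (v - u)" by (auto simp: K1_def)
      then show "emeasure \<mu> (case i of (u, v) \<Rightarrow> {u..v}) \<le> ennreal p * emeasure lborel (case i of (u, v) \<Rightarrow> {u..v})"
        using p by (simp add: uv \<mu> ennreal_mult[symmetric])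
    qed auto
    have 2: "emeasure lborel J \<le> ennreal (1 / q) * emeasure \<mu> J"
      unfolding J_def
    proof (rule emeasure_disjoint_Union_le[OF C2(1,3) sets[symmetric]])
      fix i assume i: "i \<in> C2"
      obtain u v where uv: "i = (u, v)" by (cases i)
      with i C2(2) have *: "u < v" "f v - f u > q * (v - u)" by (auto simp: K2_def)
      then have "v - u \<le> 1 / q * (f v - f u)" using p pq by (simp add: field_simps)
      then show "emeasure lborel (case i of (u, v) \<Rightarrow> {u..v}) \<le> ennreal (1 / q) * emeasure \<mu> (case i of (u, v) \<Rightarrow> {u..v})"
        using p pq * mono[of u v] by (simp add: uv \<mu> ennreal_mult[symmetric])
    qed (auto simp: \<mu>_def)
    have "emeasure lborel J \<le> ennreal (1 / q) * emeasure \<mu> I"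
      using \<open>J \<subseteq> V\<close> \<open>V \<subseteq> I\<close> IJ
      by (intro order_trans[OF 2] mult_left_mono emeasure_mono) (auto simp: \<mu>_def)
    also have "\<dots> \<le> ennreal (1 / q) * (ennreal p * emeasure lborel I)"
      using 1 by (intro mult_left_mono) auto
    also have "\<dots> \<le> ennreal (1 / q) * (ennreal p * emeasure lborel U)"
      using \<open>I \<subseteq> U\<close> U(1) by (intro mult_left_mono emeasure_mono) auto
    also have "emeasure lborel U = ennreal (measure lebesgue U)"
      using U(1) emeasure_eq_measure2[OF U(2)] by simp
    also have "ennreal (1 / q) * (ennreal p * ennreal (measure lebesgue U)) = ennreal (p / q * measure lebesgue U)"
      using p pq by (simp add: ennreal_mult[symmetric])
    finally have J: "emeasure lborel J \<le> ennreal (p / q * measure lebesgue U)" .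
    have m_J: "m \<le> p / q * measure lebesgue U + e'" if e': "e' > 0" for e'
    proof -
      define T0 where "T0 = J \<union> ((S - V) \<union> (S \<inter> V - J))"
      have negN: "negligible ((S - V) \<union> (S \<inter> V - J))"
        using neg1 C2(4) unfolding J_def by (intro negligible_Un) (auto simp: case_prod_beta)
      have T0: "T0 \<in> sets lebesgue" "emeasure lebesgue T0 = emeasure lborel J"
        unfolding T0_def using IJ(2) negN
        by (auto simp: negligible_iff_null_sets emeasure_Un_null_set)
      obtain T where T: "open T" "T0 \<subseteq> T" "T - T0 \<in> lmeasurable" "emeasure lebesgue (T - T0) < ennreal e'"
        using sets_lebesgue_outer_open[OF T0(1) e'] by blast
      have "emeasure lebesgue T \<le> emeasure lebesgue T0 + emeasure lebesgue (T - T0)"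
        using T T0 emeasure_subadditive[of T0 lebesgue "T - T0"] by (simp add: Un_absorb1 fmeasurableD)
      also have "\<dots> \<le> ennreal (p / q * measure lebesgue U) + ennreal e'"
        using J T0(2) T(4) by (intro add_mono) auto
      also have "\<dots> = ennreal (p / q * measure lebesgue U + e')"
        using p pq e' by simp
      finally have eT: "emeasure lebesgue T \<le> ennreal (p / q * measure lebesgue U + e')" .
      have "T \<in> lmeasurable"
        using T(1) eT by (intro fmeasurableI) (auto simp: less_top[symmetric] top_unique)
      then have "T \<in> \<U>" using T(1,2) unfolding \<U>_def T0_def by blast
      moreover have "measure lebesgue T \<le> p / q * measure lebesgue U + e'"
        using eT p pq e' unfolding measure_def by (intro enn2real_leI) auto
      ultimately show ?thesis using m_le[of T] by linarith
    qed
    have "m \<le> p / q * measure lebesgue U" using m_J by (rule field_le_epsilon)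
    also have "\<dots> \<le> p / q * (m + e)" using U(4) p pq by (intro mult_left_mono) auto
    finally show ?thesis using p pq by (simp add: field_simps)
  qed
  have "q * m \<le> p * m + e" if "e > 0" for e
    using le[of "e / p"] that p by (simp add: distrib_left)
  then have "q * m \<le> p * m" by (rule field_le_epsilon)
  then have "m = 0" using m0 pq by (metis less_eq_real_def linorder_not_le mult_strict_right_mono)
  show ?thesis unfolding negligible_outer
  proof (intro allI impI)
    fix e :: real assume "e > 0"
    have "\<exists>x\<in>measure lebesgue ` \<U>. x < e"
      using \<open>ball 0 R \<in> \<U>\<close> \<open>e > 0\<close> \<open>m = 0\<close> unfolding m_def by (intro cInf_lessD) auto
    then show "\<exists>T. S \<subseteq> T \<and> T \<in> lmeasurable \<and> measure lebesgue T < e"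
      unfolding \<U>_def by blast
  qed
qed simp

text \<open>
  Outside the countable union of the sets that \<open>negligible_slope_gap\<close> provides for rational \<open>p < q\<close>, the upper and lower
  limits of the slopes of small intervals around a point agree; the Lipschitz bound makes them finite.
\<close>

lemma ae_differentiable_mono_Lipschitz:
  fixes f :: "real \<Rightarrow> real"
  assumes mono: "\<And>x y. x \<le> y \<Longrightarrow> f x \<le> f y"
    and lip: "\<And>x y. x \<le> y \<Longrightarrow> f y - f x \<le> L * (y - x)"
  shows "AE t in lebesgue. \<exists>d. (f has_real_derivative d) (at t)"
proof -
  have "L-lipschitz_on UNIV f"
  proof (rule lipschitz_onI)
    show "L \<ge> 0" using lip[of 0 1] mono[of 0 1] by simp
    show "dist (f x) (f y) \<le> L * dist x y" for x y
      using lip[of x y] lip[of y x] mono[of x y] mono[of y x] by (auto simp: dist_real_def abs_if)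
  qed
  then have cont: "continuous_on UNIV f" by (rule lipschitz_on_continuous_on)
  define lo where "lo = (\<lambda>t p. \<forall>d>0. \<exists>u v. u < v \<and> u \<le> t \<and> t \<le> v \<and> v - u < d \<and> f v - f u < p * (v - u))"
  define hi where "hi = (\<lambda>t q. \<forall>d>0. \<exists>u v. u < v \<and> u \<le> t \<and> t \<le> v \<and> v - u < d \<and> f v - f u > q * (v - u))"
  have not_lo: "\<exists>d>0. \<forall>u v. u < v \<longrightarrow> u \<le> t \<longrightarrow> t \<le> v \<longrightarrow> v - u < d \<longrightarrow> p * (v - u) \<le> f v - f u"
    if "\<not> lo t p" for t p
  proof -
    have "\<exists>d>0. \<forall>u v. \<not> (u < v \<and> u \<le> t \<and> t \<le> v \<and> v - u < d \<and> f v - f u < p * (v - u))"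
      using that unfolding lo_def by blast
    then show ?thesis unfolding not_le[symmetric] by blast
  qed
  have not_hi: "\<exists>d>0. \<forall>u v. u < v \<longrightarrow> u \<le> t \<longrightarrow> t \<le> v \<longrightarrow> v - u < d \<longrightarrow> f v - f u \<le> q * (v - u)"
    if "\<not> hi t q" for t q
  proof -
    have "\<exists>d>0. \<forall>u v. \<not> (u < v \<and> u \<le> t \<and> t \<le> v \<and> v - u < d \<and> f v - f u > q * (v - u))"
      using that unfolding hi_def by blast
    then show ?thesis unfolding not_le[symmetric] by blast
  qed
  define B where "B = (\<Union>(p, q, n)\<in>{(p, q, n :: nat). p \<in> \<rat> \<and> q \<in> \<rat> \<and> p < q}.
      {t. \<bar>t\<bar> \<le> real n \<and> lo t p \<and> hi t q})"
  have "countable {(p :: real, q :: real, n :: nat). p \<in> \<rat> \<and> q \<in> \<rat> \<and> p < q}"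
    by (rule countable_subset[of _ "\<rat> \<times> \<rat> \<times> UNIV"]) (auto simp: countable_rat)
  then have "negligible B"
    unfolding B_def
  proof (intro negligible_countable_Union countable_image)
    fix S assume "S \<in> (\<lambda>(p, q, n). {t. \<bar>t\<bar> \<le> real n \<and> lo t p \<and> hi t q}) ` {(p, q, n). p \<in> \<rat> \<and> q \<in> \<rat> \<and> p < q}"
    then obtain p q n where S: "S = {t. \<bar>t\<bar> \<le> real n \<and> lo t p \<and> hi t q}" "p < q" by auto
    have "bounded S" unfolding S(1) bounded_iff by (intro exI[of _ "real n"]) auto
    then show "negligible S"
      by (intro negligible_slope_gap[of f p q S] mono cont S(2)) (auto simp: S(1) lo_def hi_def)
  qed
  moreover have "\<exists>d. (f has_real_derivative d) (at t)" if t: "t \<notin> B" for t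
  proof -
    obtain n :: nat where n: "\<bar>t\<bar> \<le> real n" using real_arch_simple by blast
    have gap: "\<not> lo t p \<or> \<not> hi t q" if "p \<in> \<rat>" "q \<in> \<rat>" "p < q" for p q
    proof (rule ccontr)
      assume "\<not> ?thesis"
      then have "t \<in> B"
        unfolding B_def using n that by (intro UN_I[of "(p, q, n)"]) auto
      with t show False by simp
    qed
    have noL: "\<not> hi t q" if "q \<ge> L" for q
    proof
      assume "hi t q"
      from this[unfolded hi_def, rule_format, OF zero_less_one]
      obtain u v where "u < v" "f v - f u > q * (v - u)" by blast
      moreover have "L * (v - u) \<le> q * (v - u)" using that \<open>u < v\<close> by (intro mult_right_mono) auto
      ultimately show False using lip[of u v] by linarith
    qed
    have hi0: "hi t q" if "q < 0" for q
      unfolding hi_def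
    proof (intro allI impI)
      fix d :: real assume "d > 0"
      have neg: "q * (d / 2) < 0" using that \<open>d > 0\<close> by (intro mult_neg_pos) auto
      show "\<exists>u v. u < v \<and> u \<le> t \<and> t \<le> v \<and> v - u < d \<and> f v - f u > q * (v - u)"
        by (rule exI[of _ t], rule exI[of _ "t + d / 2"])
           (use mono[of t "t + d / 2"] \<open>d > 0\<close> neg in auto)
    qed
    define A where "A = {q. \<not> hi t q}"
    have "L \<in> A" using noL[of L] by (simp add: A_def)
    have bdd: "bdd_below A" using hi0 unfolding A_def by (intro bdd_belowI[of _ 0]) (auto simp: not_less[symmetric])
    (* D is the upper limit of the slopes. *)
    define D where "D = Inf A"
    have up: "\<not> hi t q" if "q > D" for q
    proof -
      have "\<exists>q'\<in>A. q' < q"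
        by (rule cInf_lessD) (use that \<open>L \<in> A\<close> in \<open>auto simp: D_def\<close>)
      then obtain q' where q': "q' \<in> A" "q' < q" by blast
      then have "\<not> hi t q'" by (simp add: A_def)
      from not_hi[OF this] obtain d where d: "d > 0"
        "\<forall>u v. u < v \<longrightarrow> u \<le> t \<longrightarrow> t \<le> v \<longrightarrow> v - u < d \<longrightarrow> f v - f u \<le> q' * (v - u)"
        by (elim exE conjE)
      have le:  "q' * (v - u) \<le> q * (v - u)" if "u < v" for u v
        using that q'(2) by (intro mult_right_mono) auto
      show ?thesis
      proof
        assume "hi t q"
        from this[unfolded hi_def, rule_format, OF d(1)]
        obtain u v where uv: "u < v" "u \<le> t" "t \<le> v" "v - u < d" "f v - f u > q * (v - u)"
          by blast
        show False using d(2)[rule_format, OF uv(1-4)] le[OF uv(1)] uv(5) by linarith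
      qed
    qed
    have down: "\<not> lo t p" if "p < D" "p \<in> \<rat>" for p
    proof -
      obtain q where "q \<in> \<rat>" "p < q" "q < D" using Rats_dense_in_real[OF \<open>p < D\<close>] by blast
      moreover have "q \<notin> A"
        using cInf_lower[OF _ bdd, of q] \<open>q < D\<close> unfolding D_def by linarith
      then have "hi t q" by (simp add: A_def)
      ultimately show ?thesis using gap that by blast
    qed
    have "(f has_real_derivative D) (at t)"
      unfolding has_field_derivative_iff
    proof (rule LIM_I)
      fix e :: real assume "e > 0"
      obtain p where p: "p \<in> \<rat>" "D - e < p" "p < D" using Rats_dense_in_real[of "D - e" D] \<open>e > 0\<close> by auto
      from not_lo[OF down[OF p(3,1)]] obtain d1 where d1: "d1 > 0"
        "\<forall>u v. u < v \<longrightarrow> u \<le> t \<longrightarrow> t \<le> v \<longrightarrow> v - u < d1 \<longrightarrow> p * (v - u) \<le> f v - f u"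
        by (elim exE conjE)
      have "D + e / 2 > D" using \<open>e > 0\<close> by simp
      from not_hi[OF up[OF this]] obtain d2 where d2: "d2 > 0"
        "\<forall>u v. u < v \<longrightarrow> u \<le> t \<longrightarrow> t \<le> v \<longrightarrow> v - u < d2 \<longrightarrow> f v - f u \<le> (D + e / 2) * (v - u)"
        by (elim exE conjE)
      have "norm ((f s - f t) / (s - t) - D) < e" if s: "s \<noteq> t" "norm (s - t) < min d1 d2" for s
      proof -
        have "p \<le> (f s - f t) / (s - t) \<and> (f s - f t) / (s - t) \<le> D + e / 2"
        proof (cases "s < t")
          case True
          then have "p * (t - s) \<le> f t - f s" "f t - f s \<le> (D + e / 2) * (t - s)"
            using d1(2)[rule_format, of s t] d2(2)[rule_format, of s t] s by auto
          moreover have "(f s - f t) / (s - t) = (f t - f s) / (t - s)"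
            by (metis minus_diff_eq minus_divide_divide)
          ultimately show ?thesis using True by (simp add: pos_le_divide_eq pos_divide_le_eq)
        next
          case False
          then have "p * (s - t) \<le> f s - f t" "f s - f t \<le> (D + e / 2) * (s - t)"
            using d1(2)[rule_format, of t s] d2(2)[rule_format, of t s] s by auto
          then show ?thesis using False s(1) by (simp add: pos_le_divide_eq pos_divide_le_eq)
        qed
        then have "\<bar>(f s - f t) / (s - t) - D\<bar> < e" using p \<open>e > 0\<close> by linarith
        then show ?thesis by simp
      qed
      then show "\<exists>d>0. \<forall>s. s \<noteq> t \<and> norm (s - t) < d \<longrightarrow> norm ((f s - f t) / (s - t) - D) < e"
        using d1(1) d2(1) by (intro exI[of _ "min d1 d2"]) auto
    qed
    then show ?thesis by blast
  qed
  ultimately show ?thesis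
    by (intro AE_I'[of B]) (auto simp: negligible_iff_null_sets)
qed

text \<open>
  Adding \<open>L s\<close> to a real function with Lipschitz constant \<open>L\<close> makes it increasing.
\<close>

lemma ae_differentiable_Lipschitz:
  fixes f :: "real \<Rightarrow> complex"
  assumes "L-lipschitz_on UNIV f"
  shows "AE t in lebesgue. \<exists>d. (f has_vector_derivative d) (at t)"
proof -
  have lip: "cmod (f x - f y) \<le> L * \<bar>x - y\<bar>" for x y
    using lipschitz_onD[OF assms, of x y] by (simp add: dist_norm)
  have *: "AE t in lebesgue. \<exists>d. (h has_real_derivative d) (at t)"
    if h: "\<And>x y. \<bar>h x - h y\<bar> \<le> L * \<bar>x - y\<bar>" for h :: "real \<Rightarrow> real"
  proof -
    have "AE t in lebesgue. \<exists>d. ((\<lambda>s. h s + L * s) has_real_derivative d) (at t)"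
    proof (rule ae_differentiable_mono_Lipschitz[where L = "2 * L"])
      fix x y :: real assume "x \<le> y"
      then have "\<bar>h y - h x\<bar> \<le> L * (y - x)" using h[of y x] by simp
      then show "h x + L * x \<le> h y + L * y" "(h y + L * y) - (h x + L * x) \<le> 2 * L * (y - x)"
        by (auto simp: algebra_simps)
    qed
    then show ?thesis
    proof eventually_elim
      case (elim t)
      then obtain d where "((\<lambda>s. h s + L * s) has_real_derivative d) (at t)" by blast
      then have "((\<lambda>s. (h s + L * s) - L * s) has_real_derivative d - L) (at t)"
        by (rule DERIV_diff) (auto intro!: derivative_eq_intros)
      then show ?case by auto
    qed
  qed
  have "AE t in lebesgue. \<exists>d. ((\<lambda>t. Re (f t)) has_real_derivative d) (at t)"
    using order_trans[OF abs_Re_le_cmod lip] by (intro *) (simp flip: minus_complex.sel)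
  moreover have "AE t in lebesgue. \<exists>d. ((\<lambda>t. Im (f t)) has_real_derivative d) (at t)"
    using order_trans[OF abs_Im_le_cmod lip] by (intro *) (simp flip: minus_complex.sel)
  ultimately show ?thesis
  proof eventually_elim
    case (elim t)
    then obtain d e where "((\<lambda>t. Re (f t)) has_real_derivative d) (at t)"
      "((\<lambda>t. Im (f t)) has_real_derivative e) (at t)" by blast
    then have "(f has_vector_derivative Complex d e) (at t)"
      by (simp add: has_vector_derivative_complex_iff has_real_derivative_iff_has_vector_derivative)
    then show ?case by blast
  qed
qed

section \<open>Nontangential boundary values of Herglotz functions\<close>

definition stolz_angle :: "real \<Rightarrow> real \<Rightarrow> complex set" where
  "stolz_angle \<alpha> t = {z. 0 < Im z \<and> \<bar>Re z - t\<bar> \<le> \<alpha> * Im z}"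

definition nontangential_limit :: "(complex \<Rightarrow> complex) \<Rightarrow> real \<Rightarrow> complex \<Rightarrow> bool" where
  "nontangential_limit f t d \<longleftrightarrow>
     (\<forall>\<alpha>>0. (f \<longlongrightarrow> d) (at (of_real t) within stolz_angle \<alpha> t))"

text \<open>
  The bound gives the boundary value \<open>0\<close> on the whole real line, so that the Schwarz reflection of \<open>G\<close> is an entire
  function vanishing on the real line.
\<close>

lemma holomorphic_eq_0_of_boundary_bound:
  assumes hol: "G holomorphic_on upper_half_plane"
    and bound: "\<And>z. Im z > 0 \<Longrightarrow> cmod (G z) \<le> C * Im z" and w: "Im w > 0"
  shows "G w = 0"
proof -
  define f where "f = (\<lambda>z. if Im z > 0 then G z else 0)"
  define R where "R = (\<lambda>z. if 0 \<le> Im z then f z else cnj (f (cnj z)))"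
  have holR: "R holomorphic_on UNIV"
    unfolding R_def
  proof (rule Schwarz_reflection)
    show "f holomorphic_on UNIV \<inter> {z. 0 < Im z}"
      by (rule holomorphic_transform[of G]) (use hol in \<open>auto simp: f_def upper_half_plane_def\<close>)
    have isG: "isCont G z" if "Im z > 0" for z
      using holomorphic_derivI[OF hol open_upper_half_plane, of z] that by (intro DERIV_isCont) auto
    have "continuous (at z within {z. 0 \<le> Im z}) f" if z: "0 \<le> Im z" for z
    proof (cases "Im z > 0")
      case True
      have "\<forall>\<^sub>F x in nhds z. x \<in> upper_half_plane"
        using True by (intro eventually_nhds_in_open) auto
      then have "\<forall>\<^sub>F x in nhds z. f x = G x" by eventually_elim (simp add: f_def)
      then have "isCont f z" using isG[OF True] isCont_cong by blast
      then show ?thesis by (rule continuous_at_imp_continuous_within)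
    next
      case False
      then have z0: "Im z = 0" using z by simp
      have "(f \<longlongrightarrow> 0) (at z within {z. 0 \<le> Im z})"
      proof (rule Lim_null_comparison)
        have "cmod (f x) \<le> \<bar>C\<bar> * \<bar>Im x\<bar>" for x
        proof (cases "Im x > 0")
          case True
          then have "C * Im x \<le> \<bar>C\<bar> * Im x" by (intro mult_right_mono) auto
          from order_trans[OF bound[OF True] this] show ?thesis using True by (simp add: f_def)
        next
          case False
          have "0 \<le> \<bar>C\<bar> * \<bar>Im x\<bar>" by (intro mult_nonneg_nonneg abs_ge_zero)
          then show ?thesis by (simp only: f_def False if_False norm_zero)
        qed
        then show "\<forall>\<^sub>F x in at z within {z. 0 \<le> Im z}. cmod (f x) \<le> \<bar>C\<bar> * \<bar>Im x\<bar>" by simp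
        have "((\<lambda>x. \<bar>C\<bar> * \<bar>Im x\<bar>) \<longlongrightarrow> \<bar>C\<bar> * \<bar>Im z\<bar>) (at z within {z. 0 \<le> Im z})"
          by (intro tendsto_intros)
        then show "((\<lambda>x. \<bar>C\<bar> * \<bar>Im x\<bar>) \<longlongrightarrow> 0) (at z within {z. 0 \<le> Im z})"
          using z0 by simp
      qed
      then show ?thesis using z0 by (simp add: continuous_within f_def)
    qed
    then show "continuous_on (UNIV \<inter> {z. 0 \<le> Im z}) f"
      by (simp add: continuous_on_eq_continuous_within)
  qed (auto simp: f_def complex_is_Real_iff)
  have "R w = 0"
  proof (rule analytic_continuation[OF holR, of \<real> 0])
    show "(0 :: complex) islimpt \<real>"
      unfolding islimpt_approachable
    proof (intro allI impI)
      fix e :: real assume "e > 0"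
      then show "\<exists>x'\<in>\<real>. x' \<noteq> 0 \<and> dist x' (0 :: complex) < e"
        by (intro bexI[of _ "of_real (e / 2)"]) (auto simp: norm_divide)
    qed
  qed (auto simp: R_def f_def complex_is_Real_iff)
  then show ?thesis using w by (simp add: R_def f_def)
qed

text \<open>
  Suppose that \<open>h\<close> stays away from \<open>d\<close> along points \<open>z n\<close> of a Stolz angle at \<open>t\<close>, and rescale \<open>H\<close> around \<open>t\<close> by \<open>r n = Im (z n)\<close>.
  The rescaled functions are normal, because they are Lipschitz with constant \<open>1\<close>. A limit \<open>Q\<close> has the boundary values
  \<open>d x\<close>, by differentiability at \<open>t\<close>, and so equals \<open>d \<zeta>\<close>. As the rescaled points
  \<open>\<zeta>\<^sub>n = (z n - t) / r n\<close> stay in a compact set, Cauchy's inequality makes \<open>h (z n)\<close>, the derivative of the rescaled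
  function at \<open>\<zeta>\<^sub>n\<close>, approach \<open>d\<close> along a subsequence, which is a contradiction.
\<close>

lemma nontangential_limit_at_differentiable_point:
  assumes H: "\<And>z. Im z > 0 \<Longrightarrow> (H has_field_derivative h z) (at z)"
    and lip: "\<And>z w. Im z > 0 \<Longrightarrow> Im w > 0 \<Longrightarrow> cmod (H z - H w) \<le> cmod (z - w)"
    and bv: "\<And>s y. y > 0 \<Longrightarrow> cmod (H (Complex s y) - H0 s) \<le> y"
    and d: "(H0 has_vector_derivative d) (at t)"
  shows "nontangential_limit h t d"
  unfolding nontangential_limit_def
proof (intro allI impI)
  fix \<alpha> :: real assume \<alpha>: "\<alpha> > 0"
  show "(h \<longlongrightarrow> d) (at (of_real t) within stolz_angle \<alpha> t)"
  proof (rule ccontr)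
    assume "\<not> ?thesis"
    then have "\<exists>e>0. \<forall>\<delta>>0. \<exists>z\<in>stolz_angle \<alpha> t. dist z (of_real t) < \<delta> \<and> \<not> dist (h z) d < e"
      unfolding Lim_within by blast
    then obtain e where e: "e > 0"
      and far: "\<forall>\<delta>>0. \<exists>z\<in>stolz_angle \<alpha> t. dist z (of_real t) < \<delta> \<and> \<not> dist (h z) d < e"
      by (elim exE conjE)
    have "\<exists>z. z \<in> stolz_angle \<alpha> t \<and> dist z (of_real t) < inverse (real (Suc n)) \<and> \<not> dist (h z) d < e" for n
    proof -
      have "inverse (real (Suc n)) > 0" by simp
      from far[rule_format, OF this] show ?thesis by blast
    qed
    then have "\<forall>n. \<exists>z. z \<in> stolz_angle \<alpha> t \<and> dist z (of_real t) < inverse (real (Suc n)) \<and> \<not> dist (h z) d < e"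
      by (rule allI)
    from choice[OF this] obtain z where z': "\<forall>n. z n \<in> stolz_angle \<alpha> t \<and> dist (z n) (of_real t) < inverse (real (Suc n)) \<and> \<not> dist (h (z n)) d < e"
      by (elim exE)
    have z: "z n \<in> stolz_angle \<alpha> t" "dist (z n) (of_real t) < inverse (real (Suc n))" "\<not> dist (h (z n)) d < e" for n
      using spec[OF z', of n] by simp_all
    define r where "r = (\<lambda>n. Im (z n))"
    have r: "r n > 0" "\<bar>Re (z n) - t\<bar> \<le> \<alpha> * r n" for n
      using z(1)[of n] by (auto simp: r_def stolz_angle_def)
    have "r n \<le> inverse (real (Suc n))" for n
      using abs_Im_le_cmod[of "z n - of_real t"] z(2)[of n] by (simp add: r_def dist_norm)
    then have r0: "r \<longlonglongrightarrow> 0"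
      using r(1) by (intro real_tendsto_sandwich[OF _ _ tendsto_const LIMSEQ_inverse_real_of_nat])
        (auto simp: less_imp_le)
    define P where "P = (\<lambda>n \<zeta>. (H (of_real t + of_real (r n) * \<zeta>) - H0 t) / of_real (r n))"
    have dP: "(P n has_field_derivative h (of_real t + of_real (r n) * \<zeta>)) (at \<zeta>)" if "Im \<zeta> > 0" for n \<zeta>
    proof -
      have "((\<lambda>\<zeta>. H (of_real t + of_real (r n) * \<zeta>)) has_field_derivative
          h (of_real t + of_real (r n) * \<zeta>) * of_real (r n)) (at \<zeta>)"
        by (rule DERIV_chain2[OF H]) (use that r(1)[of n] in \<open>auto intro!: derivative_eq_intros\<close>)
      then have "(P n has_field_derivative (h (of_real t + of_real (r n) * \<zeta>) * of_real (r n) - 0) / of_real (r n)) (at \<zeta>)"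
        unfolding P_def by (intro DERIV_cdivide DERIV_diff DERIV_const)
      then show ?thesis using r(1)[of n] by simp
    qed
    have P_hol: "P n holomorphic_on upper_half_plane" for n
      unfolding holomorphic_on_open[OF open_upper_half_plane]
      by (intro ballI exI, rule dP) simp
    have H_H0: "cmod (H w - H0 t) \<le> cmod (w - of_real t)" if w: "Im w > 0" for w
    proof (rule field_le_epsilon)
      fix y :: real assume y: "y > 0"
      have "cmod (H w - H0 t) \<le> cmod (H w - H (Complex t (y/2))) + cmod (H (Complex t (y/2)) - H0 t)"
        using norm_triangle_ineq[of "H w - H (Complex t (y/2))" "H (Complex t (y/2)) - H0 t"] by simp
      also have "\<dots> \<le> cmod (w - Complex t (y/2)) + y/2"
        using lip[OF w, of "Complex t (y/2)"] bv[of "y/2" t] y by (intro add_mono) auto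
      also have "w - Complex t (y/2) = (w - of_real t) - \<i> * of_real (y/2)"
        by (simp add: complex_eq_iff)
      also have "cmod \<dots> + y/2 \<le> (cmod (w - of_real t) + y/2) + y/2"
        using norm_triangle_ineq4[of "w - of_real t" "\<i> * of_real (y/2)"] y
        by (simp add: norm_mult del: of_real_divide)
      finally show "cmod (H w - H0 t) \<le> cmod (w - of_real t) + y" by simp
    qed
    have P_le: "cmod (P n \<zeta>) \<le> cmod \<zeta>" if "Im \<zeta> > 0" for n \<zeta>
    proof -
      have "cmod (P n \<zeta>) \<le> cmod (of_real (r n) * \<zeta>) / r n"
        using H_H0[of "of_real t + of_real (r n) * \<zeta>"] that r(1)[of n]
        by (simp add: P_def norm_divide divide_right_mono)
      then show ?thesis using r(1)[of n] by (simp add: norm_mult)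
    qed
    obtain Q k where Q: "Q holomorphic_on upper_half_plane" and k: "strict_mono (k :: nat \<Rightarrow> nat)"
      and lim: "\<And>\<zeta>. \<zeta> \<in> upper_half_plane \<Longrightarrow> (\<lambda>n. P (k n) \<zeta>) \<longlonglongrightarrow> Q \<zeta>"
      and ulim: "\<And>K. compact K \<Longrightarrow> K \<subseteq> upper_half_plane \<Longrightarrow> uniform_limit K (P \<circ> k) Q sequentially"
    proof (rule Montel[where \<F> = P and S = upper_half_plane and \<H> = "range P"])
      fix K assume K: "compact K" "K \<subseteq> upper_half_plane"
      obtain B where "\<And>\<zeta>. \<zeta> \<in> K \<Longrightarrow> cmod \<zeta> \<le> B"
        using compact_imp_bounded[OF K(1)] unfolding bounded_iff by blast
      then have "cmod (P n \<zeta>) \<le> B" if "\<zeta> \<in> K" for n \<zeta>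
        using order_trans[OF P_le[of \<zeta> n]] subsetD[OF K(2) that] that by simp
      then show "\<exists>B. \<forall>h\<in>range P. \<forall>z\<in>K. cmod (h z) \<le> B" by blast
    qed (use P_hol in auto)
    have quot: "(\<lambda>n. (H0 (t + r n * x) - H0 t) / of_real (r n) - d * of_real x) \<longlonglongrightarrow> 0" for x
    proof (rule LIMSEQ_I)
      fix \<epsilon> :: real assume \<epsilon>: "\<epsilon> > 0"
      (* The summand 1 covers the case x = 0. *)
      define \<epsilon>' where "\<epsilon>' = \<epsilon> / (\<bar>x\<bar> + 1)"
      have \<epsilon>': "\<epsilon>' > 0" "\<epsilon>' * \<bar>x\<bar> < \<epsilon>" using \<epsilon> by (auto simp: \<epsilon>'_def field_simps)
      have "\<exists>\<delta>>0. \<forall>s. norm (s - t) < \<delta> \<longrightarrow> cmod (H0 s - H0 t - (s - t) *\<^sub>R d) \<le> \<epsilon>' * norm (s - t)"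
        using d \<epsilon>'(1) unfolding has_vector_derivative_def has_derivative_at_alt by simp
      then obtain \<delta> where \<delta>: "\<delta> > 0"
        "\<forall>s. norm (s - t) < \<delta> \<longrightarrow> cmod (H0 s - H0 t - (s - t) *\<^sub>R d) \<le> \<epsilon>' * norm (s - t)"
        by (elim exE conjE)
      have "(\<lambda>n. \<bar>r n * x\<bar>) \<longlonglongrightarrow> \<bar>0 * x\<bar>" by (intro tendsto_intros r0)
      then have "\<forall>\<^sub>F n in sequentially. \<bar>r n * x\<bar> < \<delta>" using \<delta>(1) by (intro order_tendstoD(2)) auto
      then obtain n0 where n0: "\<And>n. n \<ge> n0 \<Longrightarrow> \<bar>r n * x\<bar> < \<delta>" unfolding eventually_sequentially by blast
      have "cmod ((H0 (t + r n * x) - H0 t) / of_real (r n) - d * of_real x - 0) < \<epsilon>" if "n \<ge> n0" for n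
      proof -
        have "(H0 (t + r n * x) - H0 t) / of_real (r n) - d * of_real x
            = (H0 (t + r n * x) - H0 t - (r n * x) *\<^sub>R d) / of_real (r n)"
          using r(1)[of n] by (simp add: diff_divide_distrib scaleR_conv_of_real)
        then have "cmod ((H0 (t + r n * x) - H0 t) / of_real (r n) - d * of_real x)
            = cmod (H0 (t + r n * x) - H0 t - (r n * x) *\<^sub>R d) / r n"
          using r(1)[of n] by (simp add: norm_divide)
        also have "\<dots> \<le> (\<epsilon>' * \<bar>r n * x\<bar>) / r n"
          using \<delta>(2)[rule_format, of "t + r n * x"] n0[OF that] r(1)[of n] by (intro divide_right_mono) auto
        also have "\<dots> = \<epsilon>' * \<bar>x\<bar>" using r(1)[of n] by (simp add: abs_mult)
        finally show ?thesis using \<epsilon>'(2) by simp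
      qed
      then show "\<exists>no. \<forall>n\<ge>no. cmod ((H0 (t + r n * x) - H0 t) / of_real (r n) - d * of_real x - 0) < \<epsilon>"
        by blast
    qed
    have Q_bound: "cmod (Q \<zeta> - d * \<zeta>) \<le> (1 + cmod d) * Im \<zeta>" if \<zeta>: "Im \<zeta> > 0" for \<zeta>
    proof -
      define x y where "x = Re \<zeta>" and "y = Im \<zeta>"
      have \<zeta>_eq: "\<zeta> = of_real x + \<i> * of_real y" by (simp add: complex_eq_iff x_def y_def)
      define X where "X = (\<lambda>n. (H0 (t + r n * x) - H0 t) / of_real (r n) - d * of_real x)"
      have "cmod (P n \<zeta> - d * \<zeta>) \<le> cmod (X n) + (1 + cmod d) * y" for n
      proof -
        have "cmod (P n \<zeta> - (H0 (t + r n * x) - H0 t) / of_real (r n)) = cmod (H (Complex (t + r n * x) (r n * y)) - H0 (t + r n * x)) / r n"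
        proof -
          have "of_real t + of_real (r n) * \<zeta> = Complex (t + r n * x) (r n * y)"
            by (simp add: complex_eq_iff x_def y_def)
          then show ?thesis using r(1)[of n]
            by (simp add: P_def diff_divide_distrib[symmetric] norm_divide)
        qed
        also have "\<dots> \<le> (r n * y) / r n"
          using bv[of "r n * y" "t + r n * x"] r(1)[of n] \<zeta> by (intro divide_right_mono) (auto simp: y_def)
        finally have 1: "cmod (P n \<zeta> - (H0 (t + r n * x) - H0 t) / of_real (r n)) \<le> y"
          using r(1)[of n] by simp
        have "P n \<zeta> - d * \<zeta> = (P n \<zeta> - (H0 (t + r n * x) - H0 t) / of_real (r n)) + X n - d * (\<i> * of_real y)"
          unfolding X_def by (subst (2) \<zeta>_eq) (simp add: algebra_simps)
        also have "cmod \<dots> \<le> cmod (P n \<zeta> - (H0 (t + r n * x) - H0 t) / of_real (r n)) + cmod (X n) + cmod (d * (\<i> * of_real y))"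
          by (rule order_trans[OF norm_triangle_ineq4 add_right_mono[OF norm_triangle_ineq]])
        also have "cmod (d * (\<i> * of_real y)) = cmod d * y" using \<zeta> by (simp add: norm_mult y_def)
        finally show ?thesis using 1 by (simp add: algebra_simps)
      qed
      moreover have "(\<lambda>n. cmod (P (k n) \<zeta> - d * \<zeta>)) \<longlonglongrightarrow> cmod (Q \<zeta> - d * \<zeta>)"
        using lim[of \<zeta>] \<zeta> by (intro tendsto_intros) auto
      moreover have "(\<lambda>n. cmod (X (k n)) + (1 + cmod d) * y) \<longlonglongrightarrow> 0 + (1 + cmod d) * y"
        using LIMSEQ_subseq_LIMSEQ[OF quot k, of x] unfolding X_def o_def
        by (intro tendsto_intros tendsto_norm_zero)
      ultimately show ?thesis
        using LIMSEQ_le[of "\<lambda>n. cmod (P (k n) \<zeta> - d * \<zeta>)" _ "\<lambda>n. cmod (X (k n)) + (1 + cmod d) * y"]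
        unfolding y_def by simp
    qed
    have "(\<lambda>\<zeta>. Q \<zeta> - d * \<zeta>) holomorphic_on upper_half_plane"
      using Q by (intro holomorphic_intros)
    then have Q_eq: "Q \<zeta> = d * \<zeta>" if "Im \<zeta> > 0" for \<zeta>
      using holomorphic_eq_0_of_boundary_bound[of "\<lambda>\<zeta>. Q \<zeta> - d * \<zeta>", OF _ Q_bound that] by simp
    (* A box in the upper half plane that contains the discs of radius 1/2 around
       all points of height 1 in the Stolz angle. *)
    define K where "K = cbox (Complex (- (\<alpha> + 1)) (1/2)) (Complex (\<alpha> + 1) (3/2))"
    have KU: "K \<subseteq> upper_half_plane" by (auto simp: K_def in_cbox_complex_iff)
    have "uniform_limit K (P \<circ> k) Q sequentially"
      by (rule ulim[OF _ KU]) (simp add: K_def)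
    then have "\<forall>\<^sub>F n in sequentially. \<forall>\<zeta>\<in>K. dist ((P \<circ> k) n \<zeta>) (Q \<zeta>) < e / 4"
      by (rule uniform_limitD) (use e in simp)
    then obtain n where n': "\<forall>\<zeta>\<in>K. dist ((P \<circ> k) n \<zeta>) (Q \<zeta>) < e / 4"
      unfolding eventually_sequentially by blast
    have n: "cmod (P (k n) \<zeta> - d * \<zeta>) < e / 4" if "\<zeta> \<in> K" for \<zeta>
      using bspec[OF n' that] Q_eq[of \<zeta>] subsetD[OF KU that] by (simp add: dist_norm)
    define m where "m = k n"
    define \<zeta>0 where "\<zeta>0 = (z m - of_real t) / of_real (r m)"
    have z_eq: "of_real t + of_real (r m) * \<zeta>0 = z m" using r(1)[of m] by (simp add: \<zeta>0_def)
    have Im0: "Im \<zeta>0 = 1" using r(1)[of m] by (simp add: \<zeta>0_def r_def)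
    have Re0: "\<bar>Re \<zeta>0\<bar> \<le> \<alpha>" using r[of m] by (simp add: \<zeta>0_def abs_divide pos_divide_le_eq)
    have ballK: "cball \<zeta>0 (1/2) \<subseteq> K"
    proof
      fix \<zeta> assume "\<zeta> \<in> cball \<zeta>0 (1/2)"
      then have "\<bar>Re \<zeta> - Re \<zeta>0\<bar> \<le> 1/2" "\<bar>Im \<zeta> - Im \<zeta>0\<bar> \<le> 1/2"
        using abs_Re_le_cmod[of "\<zeta> - \<zeta>0"] abs_Im_le_cmod[of "\<zeta> - \<zeta>0"]
        by (auto simp: dist_norm norm_minus_commute)
      then show "\<zeta> \<in> K"
        using Re0 Im0 unfolding K_def in_cbox_complex_iff complex.sel abs_le_iff atLeastAtMost_iff
        by linarith
    qed
    have hol: "(\<lambda>\<zeta>. P m \<zeta> - d * \<zeta>) holomorphic_on upper_half_plane"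
      by (intro holomorphic_intros P_hol)
    have "cmod ((deriv ^^ 1) (\<lambda>\<zeta>. P m \<zeta> - d * \<zeta>) \<zeta>0) \<le> fact 1 * (e / 4) / (1/2) ^ 1"
    proof (rule Cauchy_inequality)
      show "(\<lambda>\<zeta>. P m \<zeta> - d * \<zeta>) holomorphic_on ball \<zeta>0 (1/2)"
        using ballK KU ball_subset_cball by (intro holomorphic_on_subset[OF hol]) blast
      show "continuous_on (cball \<zeta>0 (1/2)) (\<lambda>\<zeta>. P m \<zeta> - d * \<zeta>)"
        using ballK KU by (intro holomorphic_on_imp_continuous_on holomorphic_on_subset[OF hol]) blast
      show "cmod (P m x - d * x) \<le> e / 4" if "cmod (\<zeta>0 - x) = 1/2" for x
      proof -
        have "x \<in> K" using subsetD[OF ballK, of x] that by (simp add: dist_norm)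
        from n[OF this] show ?thesis unfolding m_def by simp
      qed
    qed simp
    moreover have "deriv (\<lambda>\<zeta>. P m \<zeta> - d * \<zeta>) \<zeta>0 = h (z m) - d"
      using dP[of \<zeta>0 m] Im0 z_eq
      by (intro DERIV_imp_deriv) (auto intro!: derivative_eq_intros)
    ultimately have "cmod (h (z m) - d) \<le> e / 2" by simp
    then show False using z(3)[of m] e by (simp add: dist_norm)
  qed
qed

text \<open>
  A primitive of \<open>h\<close> has Lipschitz constant \<open>1\<close>, extends to the real line, and its extension is differentiable almost
  everywhere.
\<close>

theorem Fatou_bounded:
  assumes hol: "h holomorphic_on upper_half_plane" and bound: "\<And>z. Im z > 0 \<Longrightarrow> cmod (h z) \<le> 1"
  shows "AE t in lebesgue. \<exists>d. nontangential_limit h t d"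
proof -
  have conv: "convex upper_half_plane"
    unfolding upper_half_plane_def by (rule convex_halfspace_Im_gt)
  obtain H where H': "\<And>z. z \<in> upper_half_plane \<Longrightarrow> (H has_field_derivative h z) (at z within upper_half_plane)"
    using holomorphic_convex_primitive'[OF conv open_upper_half_plane hol] by blast
  have lip: "cmod (H z - H w) \<le> cmod (z - w)" if "Im z > 0" "Im w > 0" for z w
    using field_differentiable_bound[OF conv H', of 1 z w] bound that by simp
  have H: "(H has_field_derivative h z) (at z)" if "Im z > 0" for z
    using H'[of z] that at_within_open[OF _ open_upper_half_plane, of z] by simp
  have lip': "1-lipschitz_on upper_half_plane H"
    using lip by (auto intro!: lipschitz_onI simp: dist_norm)
  define X where "X = (\<lambda>s n. Complex s (inverse (real (Suc n))))"
  have "convergent (\<lambda>n. H (X s n))" for s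
  proof -
    have "X s \<longlonglongrightarrow> Complex s 0"
      unfolding X_def by (intro tendsto_Complex tendsto_const LIMSEQ_inverse_real_of_nat)
    from uniformly_continuous_on_Cauchy[OF lipschitz_on_uniformly_continuous[OF lip'] LIMSEQ_imp_Cauchy[OF this]]
    have "Cauchy (\<lambda>n. H (X s n))" by (simp add: X_def)
    then show ?thesis by (rule Cauchy_convergent)
  qed
  then have "\<forall>s. \<exists>l. (\<lambda>n. H (X s n)) \<longlonglongrightarrow> l" by (simp add: convergent_def)
  then obtain H0 where H0: "\<And>s. (\<lambda>n. H (X s n)) \<longlonglongrightarrow> H0 s" by metis
  have bv: "cmod (H (Complex s y) - H0 s) \<le> y" if y: "y > 0" for s y
  proof (rule LIMSEQ_le)
    show "(\<lambda>n. cmod (H (Complex s y) - H (X s n))) \<longlonglongrightarrow> cmod (H (Complex s y) - H0 s)"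
      by (intro tendsto_intros H0)
    show "(\<lambda>n. y + inverse (real (Suc n))) \<longlonglongrightarrow> y"
      using tendsto_add[OF tendsto_const LIMSEQ_inverse_real_of_nat, of y] by simp
    have "cmod (H (Complex s y) - H (X s n)) \<le> y + inverse (real (Suc n))" for n
    proof -
      have "Complex s y - Complex s y' = \<i> * of_real (y - y')" for y'
        by (simp add: complex_eq_iff)
      then have "Complex s y - X s n = \<i> * of_real (y - inverse (real (Suc n)))"
        unfolding X_def .
      then have "cmod (Complex s y - X s n) = \<bar>y - inverse (real (Suc n))\<bar>"
        by (simp only: norm_mult norm_ii norm_of_real mult_1)
      also have "\<dots> \<le> y + inverse (real (Suc n))" using y by (simp add: abs_if)
      finally show ?thesis
        using order_trans[OF lip[of "Complex s y" "X s n"]] y by (simp add: X_def)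
    qed
    then show "\<exists>N. \<forall>n\<ge>N. cmod (H (Complex s y) - H (X s n)) \<le> y + inverse (real (Suc n))" by blast
  qed
  have "1-lipschitz_on UNIV H0"
  proof (rule lipschitz_onI)
    fix s s' :: real
    have "cmod (H0 s - H0 s') \<le> \<bar>s - s'\<bar>"
    proof (rule field_le_epsilon)
      fix y :: real assume y: "y > 0"
      let ?z = "Complex s (y/2)" and ?w = "Complex s' (y/2)"
      have "H0 s - H0 s' = (H ?z - H ?w) + (H ?w - H0 s') - (H ?z - H0 s)" by simp
      also have "cmod \<dots> \<le> cmod (H ?z - H ?w) + cmod (H ?w - H0 s') + cmod (H ?z - H0 s)"
        by (rule order_trans[OF norm_triangle_ineq4 add_right_mono[OF norm_triangle_ineq]])
      also have "\<dots> \<le> cmod (?z - ?w) + y/2 + y/2"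
        using y by (intro add_mono lip bv) auto
      also have "?z - ?w = of_real (s - s')" by (simp add: complex_eq_iff)
      also have "cmod \<dots> = \<bar>s - s'\<bar>" by (rule norm_of_real)
      finally show "cmod (H0 s - H0 s') \<le> \<bar>s - s'\<bar> + y" by simp
    qed
    then show "dist (H0 s) (H0 s') \<le> 1 * dist s s'" by (simp add: dist_norm)
  qed simp
  from ae_differentiable_Lipschitz[OF this] show ?thesis
  proof eventually_elim
    case (elim t)
    then show ?case using nontangential_limit_at_differentiable_point[OF H lip bv] by blast
  qed
qed

lemma nontangential_limit_imp_vertical:
  assumes "nontangential_limit f t d"
  shows "((\<lambda>y. f (Complex t y)) \<longlongrightarrow> d) (at_right 0)"
proof -
  have "(f \<longlongrightarrow> d) (at (of_real t) within stolz_angle 1 t)"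
    using assms unfolding nontangential_limit_def by simp
  moreover have "filterlim (Complex t) (at (of_real t) within stolz_angle 1 t) (at_right 0)"
    unfolding filterlim_at
  proof
    show "\<forall>\<^sub>F y in at_right 0. Complex t y \<in> stolz_angle 1 t \<and> Complex t y \<noteq> of_real t"
      unfolding eventually_at_right_field
      by (intro exI[of _ 1]) (auto simp: stolz_angle_def complex_eq_iff)
    have "((\<lambda>y. Complex t y) \<longlongrightarrow> Complex t 0) (at_right 0)"
      by (intro tendsto_Complex tendsto_const tendsto_ident_at)
    then show "(Complex t \<longlongrightarrow> of_real t) (at_right 0)" by (simp add: complex_of_real_def)
  qed
  ultimately show ?thesis by (rule filterlim_compose)
qed

lemma filterlim_inverse_Suc_at_right_0: "filterlim (\<lambda>n. inverse (real (Suc n))) (at_right 0) sequentially"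
  unfolding filterlim_at using LIMSEQ_inverse_real_of_nat by simp

text \<open>
  By a primitive, the integrals over two horizontal segments differ by those over the two vertical segments that connect
  their ends.
\<close>

lemma integral_horizontal_shift:
  fixes q :: "complex \<Rightarrow> complex"
  assumes hol: "q holomorphic_on upper_half_plane" and bound: "\<And>z. Im z > 0 \<Longrightarrow> cmod (q z) \<le> 1"
    and "a \<le> b" and y: "y > 0" "y' > 0"
  shows "cmod ((LINT t|lebesgue_on {a..b}. q (Complex t y)) - (LINT t|lebesgue_on {a..b}. q (Complex t y')))
    \<le> 2 * \<bar>y - y'\<bar>"
proof -
  have conv: "convex upper_half_plane"
    unfolding upper_half_plane_def by (rule convex_halfspace_Im_gt)
  obtain P where P': "\<And>z. z \<in> upper_half_plane \<Longrightarrow> (P has_field_derivative q z) (at z within upper_half_plane)"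
    using holomorphic_convex_primitive'[OF conv open_upper_half_plane hol] by blast
  have lip: "cmod (P z - P w) \<le> cmod (z - w)" if "Im z > 0" "Im w > 0" for z w
    using field_differentiable_bound[OF conv P', of 1 z w] bound that by simp
  have P: "(P has_field_derivative q z) (at z)" if "Im z > 0" for z
    using P'[of z] that at_within_open[OF _ open_upper_half_plane, of z] by simp
  have int: "(LINT t|lebesgue_on {a..b}. q (Complex t y)) = P (Complex b y) - P (Complex a y)"
    if y: "y > 0" for y
  proof -
    have hi: "((\<lambda>t. q (Complex t y)) has_integral P (Complex b y) - P (Complex a y)) {a..b}"
    proof (rule fundamental_theorem_of_calculus[OF \<open>a \<le> b\<close>])
      fix t
      have "((\<lambda>t. Complex t y) has_vector_derivative 1) (at t)"
        by (simp add: has_vector_derivative_complex_iff)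
      from field_vector_diff_chain_at[OF this P[of "Complex t y"]] y
      show "((\<lambda>t. P (Complex t y)) has_vector_derivative q (Complex t y)) (at t within {a..b})"
        by (simp add: o_def has_vector_derivative_at_within)
    qed
    have i: "integrable (lebesgue_on {a..b}) (\<lambda>t. q (Complex t y))"
    proof (rule continuous_imp_integrable_real)
      show "continuous_on {a..b} (\<lambda>t. q (Complex t y))"
        by (rule continuous_on_compose2[OF holomorphic_on_imp_continuous_on[OF hol]])
           (use y in \<open>auto intro!: continuous_intros\<close>)
    qed
    have "(LINT t|lebesgue_on {a..b}. q (Complex t y)) = integral {a..b} (\<lambda>t. q (Complex t y))"
      by (rule lebesgue_integral_eq_integral[OF i]) simp
    then show ?thesis using integral_unique[OF hi] by simp
  qed
  have vert: "cmod (P (Complex x y) - P (Complex x y')) \<le> \<bar>y - y'\<bar>" for x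
  proof -
    have "Complex x y - Complex x y' = \<i> * of_real (y - y')" by (simp add: complex_eq_iff)
    then have "cmod (Complex x y - Complex x y') = \<bar>y - y'\<bar>"
      by (simp only: norm_mult norm_ii norm_of_real mult_1)
    then show ?thesis using lip[of "Complex x y" "Complex x y'"] y by simp
  qed
  have "(P (Complex b y) - P (Complex a y)) - (P (Complex b y') - P (Complex a y'))
    = (P (Complex b y) - P (Complex b y')) - (P (Complex a y) - P (Complex a y'))" by simp
  also have "cmod \<dots> \<le> \<bar>y - y'\<bar> + \<bar>y - y'\<bar>"
    by (rule order_trans[OF norm_triangle_ineq4 add_mono[OF vert vert]])
  finally show ?thesis unfolding int[OF y(1)] int[OF y(2)] by simp
qed

text \<open>
  At each height \<open>y > 0\<close> the integral of \<open>q\<^sup>n\<close> over a segment tends to \<open>0\<close> as \<open>n \<rightarrow> \<infinity>\<close>, since \<open>\<bar>q\<bar> < 1\<close>. On the boundary, \<open>strict\<close> makes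
  \<open>q\<^sup>n\<close> tend to the indicator of the set \<open>B\<close> where \<open>q = 1\<close>, so there the integrals tend to the measure of \<open>B\<close>. By
  \<open>integral_horizontal_shift\<close> the two integrals differ by at most \<open>2 y\<close> for every \<open>n\<close>, whence \<open>B\<close> has measure at most \<open>2 y\<close>.
\<close>

lemma ae_boundary_value_neq_1:
  fixes q :: "complex \<Rightarrow> complex"
  assumes hol: "q holomorphic_on upper_half_plane" and bound: "\<And>z. Im z > 0 \<Longrightarrow> cmod (q z) < 1"
    and strict: "\<And>t l. (\<lambda>k. q (Complex t (inverse (real (Suc k))))) \<longlonglongrightarrow> l \<Longrightarrow> l = 1 \<or> cmod l < 1"
  shows "AE t in lebesgue. \<not> (\<lambda>k. q (Complex t (inverse (real (Suc k))))) \<longlonglongrightarrow> 1"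
proof -
  define y where "y = (\<lambda>k. inverse (real (Suc k)))"
  have y: "y k > 0" for k by (simp add: y_def)
  have y0: "y \<longlonglongrightarrow> 0" unfolding y_def by (rule LIMSEQ_inverse_real_of_nat)
  define qk where "qk = (\<lambda>k t. q (Complex t (y k)))"
  have "AE t in lebesgue. \<exists>d. nontangential_limit q t d"
    by (rule Fatou_bounded[OF hol less_imp_le[OF bound]])
  then have conv: "AE t in lebesgue. \<exists>l. (\<lambda>k. qk k t) \<longlonglongrightarrow> l"
  proof eventually_elim
    case (elim t)
    then obtain d where "nontangential_limit q t d" by blast
    from filterlim_compose[OF nontangential_limit_imp_vertical[OF this] filterlim_inverse_Suc_at_right_0]
    show ?case unfolding qk_def y_def by blast
  qed
  have "AE t in lebesgue. t \<in> {a..b} \<longrightarrow> \<not> (\<lambda>k. qk k t) \<longlonglongrightarrow> 1" if ab: "a \<le> b" for a b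
  proof -
    let ?M = "lebesgue_on {a..b}"
    interpret finite_measure ?M by (rule finite_measure_lebesgue_on) auto
    have meas [measurable]: "qk k \<in> borel_measurable ?M" for k
      unfolding qk_def
      by (intro continuous_imp_measurable_on_sets_lebesgue
          continuous_on_compose2[OF holomorphic_on_imp_continuous_on[OF hol]])
         (use y in \<open>auto intro!: continuous_intros\<close>)
    define qs where "qs = (\<lambda>t. lim (\<lambda>k. qk k t))"
    have qs_meas [measurable]: "qs \<in> borel_measurable ?M" unfolding qs_def by measurable
    have AE_lim: "AE t in ?M. (\<lambda>k. qk k t) \<longlonglongrightarrow> qs t"
    proof -
      have "AE t in lebesgue. t \<in> {a..b} \<longrightarrow> (\<lambda>k. qk k t) \<longlonglongrightarrow> qs t"
        using conv by eventually_elim (auto simp: qs_def limI)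
      then show ?thesis by (subst AE_restrict_space_iff) auto
    qed
    have qk_less: "cmod (qk k t) < 1" for k t unfolding qk_def using y by (intro bound) simp
    have qk_pow_le: "cmod (qk k t ^ n) \<le> 1" for k t n
      using qk_less[of k t] by (simp add: norm_power power_le_one less_imp_le)
    define I J where "I = (\<lambda>n. LINT t|?M. qs t ^ n)" and "J = (\<lambda>n k. LINT t|?M. qk k t ^ n)"
    have "(\<lambda>k. J n k) \<longlonglongrightarrow> I n" for n
      unfolding I_def J_def
    proof (rule integral_dominated_convergence[where w = "\<lambda>_. 1"])
      show "AE t in ?M. (\<lambda>k. qk k t ^ n) \<longlonglongrightarrow> qs t ^ n"
        using AE_lim by eventually_elim (rule tendsto_power)
    qed (use qk_pow_le in auto)
    moreover have J_shift: "cmod (J n k - J n l) \<le> 2 * \<bar>y k - y l\<bar>" for n k l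
      unfolding J_def qk_def
      by (rule integral_horizontal_shift[OF _ _ ab y y])
         (use hol bound in \<open>auto intro!: holomorphic_intros simp: norm_power power_le_one less_imp_le\<close>)
    ultimately have IJ: "cmod (I n - J n l) \<le> 2 * y l" for n l
    proof -
      have "(\<lambda>k. cmod (J n k - J n l)) \<longlonglongrightarrow> cmod (I n - J n l)"
        using \<open>(\<lambda>k. J n k) \<longlonglongrightarrow> I n\<close> by (intro tendsto_intros)
      moreover have "(\<lambda>k. 2 * \<bar>y k - y l\<bar>) \<longlonglongrightarrow> 2 * \<bar>0 - y l\<bar>"
        by (intro tendsto_intros y0)
      moreover have "\<exists>N. \<forall>k\<ge>N. cmod (J n k - J n l) \<le> 2 * \<bar>y k - y l\<bar>" using J_shift by blast
      ultimately have "cmod (I n - J n l) \<le> 2 * \<bar>0 - y l\<bar>" by (rule LIMSEQ_le)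
      then show ?thesis using y[of l] by simp
    qed
    have J0: "(\<lambda>n. J n l) \<longlonglongrightarrow> 0" for l
    proof -
      have "(\<lambda>n. J n l) \<longlonglongrightarrow> (LINT t|?M. 0)"
        unfolding J_def
      proof (rule integral_dominated_convergence[where w = "\<lambda>_. 1"])
        show "AE t in ?M. (\<lambda>n. qk l t ^ n) \<longlonglongrightarrow> 0"
          using LIMSEQ_power_zero[OF qk_less] by simp
      qed (use qk_pow_le in auto)
      then show ?thesis by simp
    qed
    define B where "B = {t \<in> space ?M. qs t = 1}"
    have B [measurable]: "B \<in> sets ?M" unfolding B_def by measurable
    have I_lim: "I \<longlonglongrightarrow> (LINT t|?M. indicator B t)"
      unfolding I_def
    proof (rule integral_dominated_convergence[where w = "\<lambda>_. 1"])
      have *: "AE t in ?M. qs t = 1 \<or> cmod (qs t) < 1"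
        using AE_lim by eventually_elim (rule strict, simp add: qk_def y_def)
      show "AE t in ?M. (\<lambda>n. qs t ^ n) \<longlonglongrightarrow> indicator B t"
        using * AE_space
      proof eventually_elim
        case (elim t)
        then show ?case by (cases "qs t = 1") (auto simp: B_def LIMSEQ_power_zero)
      qed
      show "AE t in ?M. cmod (qs t ^ n) \<le> 1" for n
        using * by eventually_elim (auto simp: norm_power power_le_one less_imp_le)
    qed auto
    have le_y: "cmod (LINT t|?M. indicator B t) \<le> 2 * y l" for l
    proof (rule LIMSEQ_le_const2)
      show "(\<lambda>n. cmod (I n - J n l)) \<longlonglongrightarrow> cmod (LINT t|?M. indicator B t)"
        using tendsto_norm[OF tendsto_diff[OF I_lim J0[of l]]] by simp
      show "\<exists>N. \<forall>n\<ge>N. cmod (I n - J n l) \<le> 2 * y l" using IJ by blast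
    qed
    have "(\<lambda>l. 2 * y l) \<longlonglongrightarrow> 2 * 0" by (intro tendsto_intros y0)
    then have "cmod (LINT t|?M. indicator B t) \<le> 2 * 0"
      by (rule LIMSEQ_le_const) (use le_y in blast)
    moreover have "(LINT t|?M. indicator B t) = (of_real (measure ?M B) :: complex)"
    proof -
      have "(\<lambda>t. indicator B t :: complex) = (\<lambda>t. of_real (indicator B t))"
        by (auto simp: indicator_def)
      moreover have "B \<inter> space ?M = B" by (auto simp: B_def)
      ultimately show ?thesis by (simp add: integral_complex_of_real)
    qed
    ultimately have "measure ?M B = 0" by (simp add: measure_le_0_iff)
    then have "B \<in> null_sets ?M"
      using B by (auto simp: emeasure_eq_measure)
    then have "AE t in ?M. t \<notin> B" by (rule AE_not_in)
    with AE_lim AE_space have "AE t in ?M. \<not> (\<lambda>k. qk k t) \<longlonglongrightarrow> 1"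
    proof eventually_elim
      case (elim t)
      then have "qs t \<noteq> 1" by (simp add: B_def)
      then show ?case using LIMSEQ_unique[OF elim(1)] by blast
    qed
    then show ?thesis by (subst (asm) AE_restrict_space_iff) auto
  qed
  from this[of "- real n" "real n" for n]
  have "AE t in lebesgue. \<forall>n. t \<in> {- real n..real n} \<longrightarrow> \<not> (\<lambda>k. qk k t) \<longlonglongrightarrow> 1"
    by (simp only: AE_all_countable) simp
  then show ?thesis
  proof eventually_elim
    case (elim t)
    obtain n where "\<bar>t\<bar> \<le> real n" using real_arch_simple by blast
    with elim show ?case by (auto simp: qk_def y_def abs_le_iff)
  qed
qed

text \<open>
  The map \<open>x \<mapsto> x / (x + \<i>)\<close> sends the upper half plane into the unit disc, \<open>\<infinity>\<close> to \<open>1\<close>, and finite boundary points into the open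
  disc, so the bounded theory applies and excludes the value \<open>\<infinity>\<close> almost everywhere.
\<close>

theorem Fatou_herglotz:
  assumes hol: "g holomorphic_on upper_half_plane" and up: "\<And>z. Im z > 0 \<Longrightarrow> Im (g z) > 0"
  shows "AE t in lebesgue. \<exists>d. nontangential_limit g t d"
proof -
  define q where "q = (\<lambda>z. g z / (g z + \<i>))"
  have nz: "x + \<i> \<noteq> 0" if "Im x \<ge> 0" for x using that by (auto simp: complex_eq_iff)
  have less: "cmod (x / (x + \<i>)) < 1" if "Im x \<ge> 0" for x
  proof -
    have "(cmod x)\<^sup>2 < (cmod (x + \<i>))\<^sup>2"
      using that unfolding cmod_power2 by (simp add: power2_eq_square algebra_simps)
    then have "cmod x < cmod (x + \<i>)" by (rule power_less_imp_less_base) simp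
    then show ?thesis by (simp add: norm_divide divide_less_eq)
  qed
  have up': "Im (g z) \<ge> 0" if "Im z > 0" for z using up[OF that] by simp
  have q_hol: "q holomorphic_on upper_half_plane"
    unfolding q_def using nz[OF up'] by (intro holomorphic_intros hol) auto
  have q_less: "cmod (q z) < 1" if "Im z > 0" for z
    unfolding q_def using less[OF up'[OF that]] .
  have g_eq: "g z = \<i> * q z / (1 - q z)" if "Im z > 0" for z
    using nz[OF up'[OF that]] by (simp add: q_def field_simps)
  have strict: "l = 1 \<or> cmod l < 1"
    if lim: "(\<lambda>k. q (Complex t (inverse (real (Suc k))))) \<longlonglongrightarrow> l" for t l
  proof (cases "l = 1")
    case False
    define x where "x = \<i> * l / (1 - l)"
    have "(\<lambda>k. \<i> * q (Complex t (inverse (real (Suc k)))) / (1 - q (Complex t (inverse (real (Suc k)))))) \<longlonglongrightarrow> x"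
      unfolding x_def using False by (intro tendsto_intros lim) auto
    then have "(\<lambda>k. g (Complex t (inverse (real (Suc k))))) \<longlonglongrightarrow> x" by (subst g_eq) auto
    then have "(\<lambda>k. Im (g (Complex t (inverse (real (Suc k)))))) \<longlonglongrightarrow> Im x" by (rule tendsto_Im)
    then have "Im x \<ge> 0" by (rule LIMSEQ_le_const) (auto intro!: up')
    moreover have "l = x / (x + \<i>)" using False by (simp add: x_def field_simps)
    ultimately show ?thesis using less by simp
  qed simp
  have "AE t in lebesgue. \<exists>d. nontangential_limit q t d"
    by (rule Fatou_bounded[OF q_hol less_imp_le[OF q_less]])
  moreover have "AE t in lebesgue. \<not> (\<lambda>k. q (Complex t (inverse (real (Suc k))))) \<longlonglongrightarrow> 1"
    by (rule ae_boundary_value_neq_1[OF q_hol q_less strict])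
  ultimately show ?thesis
  proof eventually_elim
    case (elim t)
    then obtain l where l: "nontangential_limit q t l" by blast
    have "l \<noteq> 1"
      using filterlim_compose[OF nontangential_limit_imp_vertical[OF l] filterlim_inverse_Suc_at_right_0] elim
      by auto
    have "nontangential_limit g t (\<i> * l / (1 - l))"
      unfolding nontangential_limit_def
    proof (intro allI impI)
      fix \<alpha> :: real assume "\<alpha> > 0"
      then have "(q \<longlongrightarrow> l) (at (of_real t) within stolz_angle \<alpha> t)"
        using l by (simp add: nontangential_limit_def)
      then have "((\<lambda>z. \<i> * q z / (1 - q z)) \<longlongrightarrow> \<i> * l / (1 - l)) (at (of_real t) within stolz_angle \<alpha> t)"
        using \<open>l \<noteq> 1\<close> by (intro tendsto_intros) auto
      moreover have "\<forall>\<^sub>F z in at (of_real t) within stolz_angle \<alpha> t. \<i> * q z / (1 - q z) = g z"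
        unfolding eventually_at_filter by (simp add: stolz_angle_def g_eq)
      ultimately show "(g \<longlongrightarrow> \<i> * l / (1 - l)) (at (of_real t) within stolz_angle \<alpha> t)"
        by (rule Lim_transform_eventually)
    qed
    then show ?case by blast
  qed
qed

section \<open>Level sets of the real part of a primitive\<close>

text \<open>
  An isolated point is determined by any member of a countable basis that contains no other point of \<open>S\<close>.
\<close>

lemma countable_isolated_points:
  "countable {x :: 'a :: second_countable_topology. x \<in> S \<and> \<not> x islimpt S}"
proof -
  obtain \<B> :: "'a set set" where \<B>: "countable \<B>" "topological_basis \<B>"
    using ex_countable_basis by blast
  have "{x. x \<in> S \<and> \<not> x islimpt S} \<subseteq> (\<lambda>U. THE x. U \<inter> S = {x}) ` \<B>"
  proof
    fix x assume "x \<in> {x. x \<in> S \<and> \<not> x islimpt S}"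
    then obtain T where T: "open T" "x \<in> T" "\<forall>y\<in>S. y \<in> T \<longrightarrow> y = x" and x: "x \<in> S"
      unfolding islimpt_def by blast
    obtain U where U: "U \<in> \<B>" "x \<in> U" "U \<subseteq> T"
      using topological_basisE[OF \<B>(2) T(1,2)] by blast
    have "U \<inter> S = {x}" using T(3) U x by blast
    then have "(THE x. U \<inter> S = {x}) = x" by (intro the_equality) auto
    then show "x \<in> (\<lambda>U. THE x. U \<inter> S = {x}) ` \<B>" using U(1) by (intro image_eqI[of _ _ U]) simp_all
  qed
  then show ?thesis using \<B>(1) by (meson countable_image countable_subset)
qed

text \<open>
  Compare \<open>t\<close> with a point \<open>s\<close> of \<open>S\<close> at distance \<open>r\<close> along the path through \<open>p = t + \<i>\<epsilon>r\<close> and \<open>p' = s + \<i>\<epsilon>r\<close>. From the boundary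
  to \<open>p\<close> or \<open>p'\<close> the function \<open>Re F\<close> changes by at most \<open>B\<epsilon>r\<close>. Between \<open>p\<close> and \<open>p'\<close> the path stays in the Stolz angle
  at \<open>t\<close> of aperture \<open>1 / \<epsilon>\<close>, so \<open>F\<close> changes by \<open>d (s - t)\<close> with an error of at most \<open>\<epsilon>r\<close>.
\<close>

lemma Re_eq_0_at_limit_point_of_level_set:
  assumes F: "\<And>z. Im z > 0 \<Longrightarrow> (F has_field_derivative g z) (at z)"
    and level: "\<And>s. s \<in> S \<Longrightarrow> ((\<lambda>y. Re (F (Complex s y))) \<longlongrightarrow> c) (at_right 0)"
    and bound: "\<And>s y. s \<in> S \<Longrightarrow> 0 < y \<Longrightarrow> y \<le> \<eta> \<Longrightarrow> cmod (g (Complex s y)) \<le> B" and "\<eta> > 0"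
    and t: "t \<in> S" "t islimpt S" and d: "nontangential_limit g t d"
  shows "Re d = 0"
proof -
  have "B \<ge> 0" using order_trans[OF norm_ge_zero bound[OF t(1) \<open>\<eta> > 0\<close> order_refl]] .
  have vert: "\<bar>Re (F (Complex s y)) - c\<bar> \<le> B * y" if s: "s \<in> S" and y: "0 < y" "y \<le> \<eta>" for s y
  proof (rule tendsto_le)
    show "((\<lambda>y'. \<bar>Re (F (Complex s y)) - Re (F (Complex s y'))\<bar>) \<longlongrightarrow> \<bar>Re (F (Complex s y)) - c\<bar>) (at_right 0)"
      by (intro tendsto_intros level s)
    show "((\<lambda>_. B * y) \<longlongrightarrow> B * y) (at_right (0 :: real))" by (rule tendsto_const)
    have "\<bar>Re (F (Complex s y)) - Re (F (Complex s y'))\<bar> \<le> B * y" if y': "0 < y'" "y' < y" for y'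
    proof -
      have mem: "Re z = s \<and> 0 < Im z \<and> Im z \<le> \<eta>" if zs: "z \<in> closed_segment (Complex s y) (Complex s y')" for z
      proof -
        obtain u where u: "0 \<le> u" "u \<le> 1" "z = (1 - u) *\<^sub>R Complex s y + u *\<^sub>R Complex s y'"
          using zs unfolding in_segment by blast
        define h where "h = u * (y - y')"
        have z: "Re z = s" "Im z = y - h" unfolding u(3) h_def by (simp_all add: algebra_simps)
        have "h \<le> 1 * (y - y')" unfolding h_def using u(2) y' by (intro mult_right_mono) auto
        moreover have "h \<ge> 0" using u(1) y' by (simp add: h_def)
        ultimately show ?thesis using z y y' by simp
      qed
      have "cmod (F (Complex s y) - F (Complex s y')) \<le> B * cmod (Complex s y - Complex s y')"
      proof (rule field_differentiable_bound[OF convex_closed_segment])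
        fix z assume "z \<in> closed_segment (Complex s y) (Complex s y')"
        note z = mem[OF this]
        show "(F has_field_derivative g z) (at z within closed_segment (Complex s y) (Complex s y'))"
          by (rule has_field_derivative_at_within, rule F) (use z in simp)
        have "Complex s (Im z) = z" using z by (simp add: complex_eq_iff)
        then show "cmod (g z) \<le> B" using bound[OF s, of "Im z"] z by simp
      qed auto
      also have "cmod (Complex s y - Complex s y') = y - y'"
        using y' by (simp add: cmod_def)
      also have "B * (y - y') \<le> B * y" using \<open>B \<ge> 0\<close> y' by (intro mult_left_mono) auto
      finally show ?thesis
        using abs_Re_le_cmod[of "F (Complex s y) - F (Complex s y')"] by simp
    qed
    then show "\<forall>\<^sub>F y' in at_right 0. \<bar>Re (F (Complex s y)) - Re (F (Complex s y'))\<bar> \<le> B * y"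
      unfolding eventually_at_right_field using y(1) by blast
  qed simp
  have main: "\<bar>Re d\<bar> \<le> \<epsilon> * (2 * B + 1)" if \<epsilon>: "\<epsilon> > 0" for \<epsilon>
  proof -
    have "(g \<longlongrightarrow> d) (at (of_real t) within stolz_angle (1 / \<epsilon>) t)"
      using d \<epsilon> by (simp add: nontangential_limit_def)
    then have "\<exists>\<delta>>0. \<forall>z\<in>stolz_angle (1 / \<epsilon>) t. 0 < dist z (of_real t) \<and> dist z (of_real t) < \<delta> \<longrightarrow> dist (g z) d < \<epsilon>"
      using \<epsilon> unfolding Lim_within by simp
    then obtain \<delta> where \<delta>: "\<delta> > 0"
      "\<forall>z\<in>stolz_angle (1 / \<epsilon>) t. 0 < dist z (of_real t) \<and> dist z (of_real t) < \<delta> \<longrightarrow> dist (g z) d < \<epsilon>"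
      by (elim exE conjE)
    have "\<exists>s\<in>S. s \<noteq> t \<and> dist s t < min (\<eta> / \<epsilon>) (\<delta> / (1 + \<epsilon>))"
      using t(2)[unfolded islimpt_approachable, rule_format, of "min (\<eta> / \<epsilon>) (\<delta> / (1 + \<epsilon>))"] \<epsilon> \<delta>(1) \<open>\<eta> > 0\<close>
      by simp
    then obtain s where s: "s \<in> S" "s \<noteq> t" "dist s t < min (\<eta> / \<epsilon>) (\<delta> / (1 + \<epsilon>))" by blast
    define r where "r = \<bar>s - t\<bar>"
    have r: "r > 0" "\<epsilon> * r \<le> \<eta>" "r + \<epsilon> * r < \<delta>"
      using s \<epsilon> by (auto simp: r_def dist_real_def field_simps)
    define p p' where "p = Complex t (\<epsilon> * r)" and "p' = Complex s (\<epsilon> * r)"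
    have seg: "Im z = \<epsilon> * r \<and> \<bar>Re z - t\<bar> \<le> r" if zs: "z \<in> closed_segment p' p" for z
    proof -
      obtain u where u: "0 \<le> u" "u \<le> 1" "z = (1 - u) *\<^sub>R p' + u *\<^sub>R p"
        using zs unfolding in_segment by blast
      have "Im z = \<epsilon> * r" "Re z - t = (1 - u) * (s - t)"
        unfolding u(3) by (simp_all add: p_def p'_def algebra_simps)
      moreover have "\<bar>(1 - u) * (s - t)\<bar> \<le> 1 * r"
        unfolding abs_mult r_def using u by (intro mult_right_mono) auto
      ultimately show ?thesis by simp
    qed
    have "cmod ((F p' - d * p') - (F p - d * p)) \<le> \<epsilon> * cmod (p' - p)"
    proof (rule field_differentiable_bound[OF convex_closed_segment])
      fix z assume "z \<in> closed_segment p' p"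
      note z = seg[OF this]
      have Im_z: "Im z > 0" using z \<epsilon> r(1) by simp
      show "((\<lambda>z. F z - d * z) has_field_derivative g z - d) (at z within closed_segment p' p)"
        by (rule has_field_derivative_at_within)
           (use F[OF Im_z] in \<open>auto intro!: derivative_eq_intros\<close>)
      have "z \<in> stolz_angle (1 / \<epsilon>) t" using z Im_z \<epsilon> by (simp add: stolz_angle_def)
      moreover have "dist z (of_real t) < \<delta>"
        using cmod_le[of "z - of_real t"] z r(3) Im_z by (simp add: dist_norm)
      moreover have "dist z (of_real t) > 0" using Im_z by auto
      ultimately show "cmod (g z - d) \<le> \<epsilon>" using \<delta>(2) by (simp add: dist_norm less_imp_le)
    qed auto
    also have diff: "p' - p = of_real (s - t)" by (simp add: p_def p'_def complex_eq_iff)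
    finally have "cmod ((F p' - d * p') - (F p - d * p)) \<le> \<epsilon> * r"
      by (simp only: norm_of_real r_def)
    also have "(F p' - d * p') - (F p - d * p) = (F p' - F p) - d * (p' - p)" by (simp add: algebra_simps)
    finally have "cmod ((F p' - F p) - d * of_real (s - t)) \<le> \<epsilon> * r" unfolding diff .
    then have "\<bar>Re ((F p' - F p) - d * of_real (s - t))\<bar> \<le> \<epsilon> * r"
      using abs_Re_le_cmod order_trans by blast
    then have "\<bar>(Re (F p') - Re (F p)) - Re d * (s - t)\<bar> \<le> \<epsilon> * r" by simp
    moreover have "\<bar>Re (F p') - c\<bar> \<le> B * (\<epsilon> * r)" "\<bar>Re (F p) - c\<bar> \<le> B * (\<epsilon> * r)"
      unfolding p_def p'_def using s(1) t(1) r \<epsilon> by (intro vert; simp)+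
    ultimately have "\<bar>Re d * (s - t)\<bar> \<le> \<epsilon> * r + 2 * (B * (\<epsilon> * r))" by linarith
    then have "\<bar>Re d\<bar> * r \<le> \<epsilon> * r + 2 * (B * (\<epsilon> * r))" by (simp only: abs_mult r_def)
    also have "\<dots> = (\<epsilon> * (2 * B + 1)) * r" by (simp add: algebra_simps)
    finally show ?thesis using r(1) by simp
  qed
  have "\<bar>Re d\<bar> \<le> 0 + e" if "e > 0" for e
  proof -
    have "2 * B + 1 > 0" using \<open>B \<ge> 0\<close> by simp
    then show ?thesis using main[of "e / (2 * B + 1)"] that by simp
  qed
  then have "\<bar>Re d\<bar> \<le> 0" by (rule field_le_epsilon)
  then show ?thesis by simp
qed

text \<open>
  Every point of the level set at which \<open>g\<close> has a finite limit belongs to one of the sets \<open>S n\<close> of points over which \<open>\<bar>g\<bar> \<le> n\<close>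
  up to height \<open>1 / (n + 1)\<close>; an exceptional point is isolated in it.
\<close>

lemma countable_exceptions_on_level_set:
  assumes F: "\<And>z. Im z > 0 \<Longrightarrow> (F has_field_derivative g z) (at z)"
  shows "countable {t. (\<exists>d. nontangential_limit g t d \<and> Re d \<noteq> 0) \<and>
    ((\<lambda>y. Re (F (Complex t y))) \<longlongrightarrow> c) (at_right 0)}"
proof -
  define S where "S = (\<lambda>n. {t. ((\<lambda>y. Re (F (Complex t y))) \<longlongrightarrow> c) (at_right 0) \<and>
    (\<forall>y. 0 < y \<and> y \<le> inverse (real (Suc n)) \<longrightarrow> cmod (g (Complex t y)) \<le> real n)})"
  have "{t. (\<exists>d. nontangential_limit g t d \<and> Re d \<noteq> 0) \<and>
    ((\<lambda>y. Re (F (Complex t y))) \<longlongrightarrow> c) (at_right 0)} \<subseteq> (\<Union>n. {t. t \<in> S n \<and> \<not> t islimpt S n})"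
  proof
    fix t assume "t \<in> {t. (\<exists>d. nontangential_limit g t d \<and> Re d \<noteq> 0) \<and>
      ((\<lambda>y. Re (F (Complex t y))) \<longlongrightarrow> c) (at_right 0)}"
    then obtain d where d: "nontangential_limit g t d" "Re d \<noteq> 0"
      and lim: "((\<lambda>y. Re (F (Complex t y))) \<longlongrightarrow> c) (at_right 0)" by blast
    have "((\<lambda>y. cmod (g (Complex t y))) \<longlongrightarrow> cmod d) (at_right 0)"
      by (intro tendsto_norm nontangential_limit_imp_vertical d)
    then have "\<forall>\<^sub>F y in at_right 0. cmod (g (Complex t y)) < cmod d + 1"
      by (rule order_tendstoD) simp
    then obtain b where b: "b > 0" "\<forall>y>0. y < b \<longrightarrow> cmod (g (Complex t y)) < cmod d + 1"
      unfolding eventually_at_right_field by blast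
    obtain n where n: "real n \<ge> max (cmod d + 1) (1 / b)" using real_arch_simple by blast
    have "inverse (real (Suc n)) < b"
    proof -
      have "1 / b < real (Suc n)" using n by simp
      then show ?thesis using b(1) by (simp add: field_simps)
    qed
    then have tS: "t \<in> S n" using lim b n unfolding S_def by (auto intro: order_trans less_imp_le)
    moreover have "\<not> t islimpt S n"
    proof
      assume lp: "t islimpt S n"
      have "Re d = 0"
      proof (rule Re_eq_0_at_limit_point_of_level_set[where S = "S n" and c = c
            and \<eta> = "inverse (real (Suc n))" and B = "real n"])
        show "cmod (g (Complex s y)) \<le> real n"
          if "s \<in> S n" "0 < y" "y \<le> inverse (real (Suc n))" for s y
          using that unfolding S_def by blast
        show "((\<lambda>y. Re (F (Complex s y))) \<longlongrightarrow> c) (at_right 0)" if "s \<in> S n" for s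
          using that unfolding S_def by blast
      qed (use F tS lp d(1) in simp_all)
      with d(2) show False by simp
    qed
    ultimately show "t \<in> (\<Union>n. {t. t \<in> S n \<and> \<not> t islimpt S n})" by blast
  qed
  moreover have "countable (\<Union>n. {t. t \<in> S n \<and> \<not> t islimpt S n})"
    by (intro countable_UN countable_isolated_points) auto
  ultimately show ?thesis by (rule countable_subset)
qed

text \<open>
  A set that is not measurable has \<^const>\<open>emeasure\<close> zero, so the fibres in question are measurable even if \<open>f\<close> is not. They are
  disjoint, hence only finitely many of them can occupy a given positive amount of a bounded interval.
\<close>

lemma countable_positive_measure_fibres:
  fixes f :: "real \<Rightarrow> 'a"
  shows "countable {c. emeasure lebesgue (f -` {c}) > 0}"
proof -
  define A where "A = (\<lambda>n c. f -` {c} \<inter> {- real n..real n})"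
  define K where "K = (\<lambda>n. {c. measure lebesgue (A n c) > inverse (real (Suc n))})"
  have "finite (K n)" for n
  proof (rule finite_if_finite_subsets_card_bdd[THEN conjunct1])
    fix X assume X: "X \<subseteq> K n" "finite X"
    have A: "A n c \<in> lmeasurable" if "c \<in> X" for c
    proof -
      have "inverse (real (Suc n)) < measure lebesgue (A n c)"
        using subsetD[OF X(1) that] by (simp add: K_def)
      then have "measure lebesgue (A n c) \<noteq> 0"
        using inverse_positive_iff_positive[of "real (Suc n)"] by linarith
      then have "A n c \<in> sets lebesgue" using measure_notin_sets by blast
      moreover have "bounded (A n c)" by (rule bounded_subset[of "{- real n..real n}"]) (auto simp: A_def)
      ultimately show ?thesis by (intro bounded_set_imp_lmeasurable)
    qed
    have "real (card X) * inverse (real (Suc n)) \<le> (\<Sum>c\<in>X. measure lebesgue (A n c))"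
      using X(1) by (intro sum_bounded_below) (auto simp: K_def)
    also have "\<dots> = measure lebesgue (\<Union>c\<in>X. A n c)"
      using A X(2) by (intro measure_UNION'[symmetric]) (auto simp: A_def pairwise_def disjnt_def)
    also have "\<dots> \<le> measure lebesgue {- real n..real n}"
    proof (rule measure_mono_fmeasurable)
      show "(\<Union>c\<in>X. A n c) \<in> sets lebesgue" using A X(2) by (intro sets.finite_UN) auto
    qed (auto simp: A_def)
    also have "\<dots> = 2 * real n" by simp
    finally have "real (card X) \<le> 2 * real n * real (Suc n)"
      by (simp only: divide_inverse[symmetric] pos_divide_le_eq of_nat_0_less_iff zero_less_Suc)
    then have "real (card X) \<le> real (2 * n * Suc n)"
      by (simp only: of_nat_mult of_nat_numeral)
    then show "card X \<le> 2 * n * Suc n" by (simp only: of_nat_le_iff)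
  qed
  moreover have "{c. emeasure lebesgue (f -` {c}) > 0} \<subseteq> (\<Union>n. K n)"
  proof (rule ccontr)
    assume "\<not> ?thesis"
    then obtain c where c: "emeasure lebesgue (f -` {c}) > 0" "\<And>n. c \<notin> K n" by blast
    then have ms: "f -` {c} \<in> sets lebesgue" by (metis emeasure_notin_sets less_irrefl)
    have lm: "A n c \<in> lmeasurable" for n
    proof (rule bounded_set_imp_lmeasurable)
      show "bounded (A n c)" by (rule bounded_subset[of "{- real n..real n}"]) (auto simp: A_def)
      show "A n c \<in> sets lebesgue" using ms unfolding A_def by (intro sets.Int) auto
    qed
    have "measure lebesgue (A m c) \<le> 0" for m
    proof (rule LIMSEQ_le_const[OF LIMSEQ_inverse_real_of_nat])
      have "measure lebesgue (A m c) \<le> inverse (real (Suc n))" if "n \<ge> m" for n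
      proof -
        have "measure lebesgue (A m c) \<le> measure lebesgue (A n c)"
          using lm that by (intro measure_mono_fmeasurable) (auto simp: A_def)
        also have "\<dots> \<le> inverse (real (Suc n))" using c(2)[of n] by (simp add: K_def)
        finally show ?thesis .
      qed
      then show "\<exists>N. \<forall>n\<ge>N. measure lebesgue (A m c) \<le> inverse (real (Suc n))" by blast
    qed
    then have "A m c \<in> null_sets lebesgue" for m
      using lm[of m] by (auto simp: null_sets_def emeasure_eq_measure2 fmeasurableD antisym)
    then have "(\<Union>m. A m c) \<in> null_sets lebesgue" by auto
    moreover have "(\<Union>m. A m c) = f -` {c}"
    proof -
      have "\<exists>m. - real m \<le> x \<and> x \<le> real m" for x
      proof -
        obtain m where "\<bar>x\<bar> \<le> real m" using real_arch_simple by blast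
        then show ?thesis by (intro exI[of _ m]) (simp add: abs_le_iff)
      qed
      then show ?thesis by (auto simp: A_def)
    qed
    ultimately show False using c(1) by auto
  qed
  ultimately show ?thesis by (meson countable_UN countable_finite countable_subset countableI_type)
qed

lemma vertical_limit_of_primitive:
  fixes F g :: "complex \<Rightarrow> complex"
  assumes F: "\<And>z. Im z > 0 \<Longrightarrow> (F has_field_derivative g z) (at z)"
    and g: "((\<lambda>y. g (Complex t y)) \<longlongrightarrow> d) (at_right 0)"
  shows "\<exists>l. ((\<lambda>y. F (Complex t y)) \<longlongrightarrow> l) (at_right 0)"
proof -
  have "((\<lambda>y. cmod (g (Complex t y))) \<longlongrightarrow> cmod d) (at_right 0)"
    by (intro tendsto_norm g)
  then have "\<forall>\<^sub>F y in at_right 0. cmod (g (Complex t y)) < cmod d + 1"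
    by (rule order_tendstoD) simp
  then obtain b where b: "b > 0" "\<forall>y>0. y < b \<longrightarrow> cmod (g (Complex t y)) < cmod d + 1"
    unfolding eventually_at_right_field by blast
  have lip: "(cmod d + 1)-lipschitz_on {0<..<b} (\<lambda>y. F (Complex t y))"
  proof (rule bounded_derivative_imp_lipschitz)
    fix y assume y: "y \<in> {0<..<b}"
    have "((\<lambda>y. Complex t y) has_vector_derivative \<i>) (at y)"
      by (simp add: has_vector_derivative_complex_iff)
    from field_vector_diff_chain_at[OF this F[of "Complex t y"]] y
    have "((\<lambda>y. F (Complex t y)) has_vector_derivative \<i> * g (Complex t y)) (at y)"
      by (simp add: o_def)
    then show "((\<lambda>y. F (Complex t y)) has_derivative (\<lambda>h. h *\<^sub>R (\<i> * g (Complex t y)))) (at y within {0<..<b})"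
      by (simp add: has_vector_derivative_def has_derivative_at_withinI)
    show "onorm (\<lambda>h. h *\<^sub>R (\<i> * g (Complex t y))) \<le> cmod d + 1"
      using b(2) y by (intro onorm_le) (simp add: norm_mult mult.commute mult_left_mono less_imp_le)
  qed (auto simp: add_nonneg_nonneg)
  have "0 \<in> closure {0<..<b}" using b(1) by (simp add: closure_greaterThanLessThan)
  from uniformly_continuous_on_extension_at_closure[OF lipschitz_on_uniformly_continuous[OF lip] this]
  obtain l where "((\<lambda>y. F (Complex t y)) \<longlongrightarrow> l) (at 0 within {0<..<b})" .
  moreover have "at 0 within {0<..<b} = at_right 0"
    by (rule at_within_nhd[of _ "{..<b}"]) (use b(1) in auto)
  ultimately show ?thesis by auto
qed

text \<open>
  Where \<open>g\<close> has a finite nontangential limit, the boundary values in the definitions of \<open>\<gamma>\<close> and \<^const>\<open>herglotz_N\<close> are genuine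
  limits. The exceptional set \<open>Z\<close> is a countable union of countable sets.
\<close>

theorem level_sets_of_primitive:
  fixes F g :: "complex \<Rightarrow> complex"
  assumes g: "herglotz g" and F: "\<And>z. Im z > 0 \<Longrightarrow> (F has_field_derivative g z) (at z)"
  defines "\<gamma> \<equiv> boundary_value (\<lambda>z. - Re (F z))"
  shows "g \<in> herglotz_N (\<gamma> -` {c. emeasure lebesgue (\<gamma> -` {c}) > 0})"
proof -
  define K where "K = {c. emeasure lebesgue (\<gamma> -` {c}) > 0}"
  define Z where "Z = (\<Union>c\<in>K. {t. (\<exists>d. nontangential_limit g t d \<and> Re d \<noteq> 0) \<and>
    ((\<lambda>y. Re (F (Complex t y))) \<longlongrightarrow> - c) (at_right 0)})"
  have "countable K" unfolding K_def by (rule countable_positive_measure_fibres)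
  then have "countable Z"
    unfolding Z_def using countable_exceptions_on_level_set[OF F] by (intro countable_UN) auto
  then have "Z \<in> null_sets lebesgue"
    using countable_imp_negligible negligible_iff_null_sets by blast
  then have Z: "AE t in lebesgue. t \<notin> Z" by (rule AE_not_in)
  have hol: "g holomorphic_on upper_half_plane" and up: "\<And>z. Im z > 0 \<Longrightarrow> Im (g z) > 0"
    using g unfolding herglotz_def image_subset_iff by simp_all
  have "AE t in lebesgue. \<exists>d. nontangential_limit g t d" by (rule Fatou_herglotz[OF hol up])
  then have "AE t in lebesgue. t \<in> \<gamma> -` K \<longrightarrow> Re (boundary_value g t) = 0"
    using Z
  proof eventually_elim
    case (elim t)
    then obtain d where d: "nontangential_limit g t d" by blast
    note vert = nontangential_limit_imp_vertical[OF d]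
    have bv: "boundary_value g t = d"
      unfolding boundary_value_def by (rule tendsto_Lim[OF _ vert]) simp
    obtain l0 where "((\<lambda>y. F (Complex t y)) \<longlongrightarrow> l0) (at_right 0)"
      using vertical_limit_of_primitive[OF F vert] by blast
    from tendsto_Re[OF this] obtain l where l: "((\<lambda>y. Re (F (Complex t y))) \<longlongrightarrow> l) (at_right 0)" by blast
    have "\<gamma> t = - l"
      unfolding \<gamma>_def boundary_value_def
      by (rule tendsto_Lim[OF _ tendsto_minus[OF l]]) simp
    then have "Re d = 0" if "\<gamma> t \<in> K"
      using that elim(2) d l unfolding Z_def by auto
    then show ?case using bv by simp
  qed
  then show ?thesis using g unfolding herglotz_N_def K_def by simp
qed

theorem corollary1p5:
  fixes a b :: "nat \<Rightarrow> real" and M A :: real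
    and E :: "real \<Rightarrow> (nat \<Rightarrow> complex) \<Rightarrow> (nat \<Rightarrow> complex)"
    and N :: "nat \<Rightarrow> nat"
    and w\<^sub>p w\<^sub>m g :: "complex \<Rightarrow> complex"
    and \<nu> \<kappa> :: "real measure"
  assumes "M > 0"
    and "a 0 = 1"
    and "\<And>n. n \<ge> 1 \<Longrightarrow> inverse (M + 1) \<le> a n \<and> a n \<le> M + 1"
    and "\<And>n. n \<ge> 1 \<Longrightarrow> \<bar>b n\<bar> \<le> M"
    and "spectral_resolution (jacobi a b) E"
    and "filterlim N at_top sequentially"
    and "herglotz w\<^sub>p" and "loc_unif_limit (\<lambda>j. w_plus_avg a b (N j)) w\<^sub>p"
    and "herglotz w\<^sub>m" and "loc_unif_limit (\<lambda>j. w_minus_avg a b (N j)) w\<^sub>m"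
    and "herglotz g" and "loc_unif_limit (\<lambda>j. green_avg a b (N j)) g"
    and "prob_space \<nu>" and "sets \<nu> = sets borel"
    and "weak_star_limit (\<lambda>j. nu_avg E (N j)) \<nu>"
    and "prob_space \<kappa>" and "sets \<kappa> = sets borel"
    and "weak_star_limit (\<lambda>j. dk_avg a b (N j)) \<kappa>"
    and "A > 0" and "(\<lambda>j. root (N j) (\<Prod>n=1..N j. a n)) \<longlonglongrightarrow> A"
  shows "let \<gamma> = lyapunov_exponent w\<^sub>p;
             K = {c. emeasure lebesgue (\<gamma> -` {c}) > 0};
             C = \<gamma> -` K
         in g \<in> herglotz_N C"
proof -
  interpret jacobi_coefficients a b M using assms(1-4) by unfold_locales
  have "(w\<^sub>p has_field_derivative g z) (at z)" if "Im z > 0" for z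
    using deriv_w_plus_limit[OF assms(6,8,12) that] .
  from level_sets_of_primitive[OF assms(11) this] show ?thesis
    unfolding Let_def lyapunov_exponent_def .
qed

end
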